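(* For any complex Banach space $E$, the Banach space $G^\infty(E)$ does not have strongly exposed points; hence $G^\infty(E)$ fails to have the Radon-Nikodým property.
   Context: $B_E$ is the open unit ball of $E$, and $\mathcal{H}^\infty(B_E)$ is the Banach space of bounded holomorphic functions $f:B_E\to\mathbb{C}$ with the supremum norm. $G^\infty(E)$ is the predual of $\mathcal{H}^\infty(B_E)$ given by Mujica, namely $$G^\infty(E)=\{\varphi\in \mathcal{H}^\infty(B_E)^* : \varphi \text{ restricted to the unit ball of } \mathcal{H}^\infty(B_E) \text{ endowed with } \tau_c \text{ is continuous}\},$$ where $\tau_c$ is the compact-open topology. A unit vector $x$ in a Banach space $X$ (with open unit ball $B_X$) is strongly exposed if there is a unit vector $x^*\in X^*$ such that $x^*(x)=1$ and every sequence $(x_n)\subseteq B_X$ with $\operatorname{Re} x^*(x_n)\to 1$ converges to $x$ in norm. A Banach space has the Radon-Nikodým property if and only if every bounded closed convex subset of it is the closed convex hull of its strongly exposed points.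
   Formalization: E is assumed to be nonzero: for E = {0} the space G^∞(E) is the complex line, which has strongly exposed points and the Radon-Nikodým property, so the claim fails there. *)

theory Defs
  imports "HOL-Analysis.Analysis"
begin

section \<open>Complex normed and Banach spaces\<close>

class scaleC = scaleR +
  fixes scaleC :: "complex \<Rightarrow> 'a \<Rightarrow> 'a"  (infixr "*\<^sub>C" 75)

class complex_normed_vector = real_normed_vector + scaleC +
  assumes scaleC_add_right: "c *\<^sub>C (x + y) = c *\<^sub>C x + c *\<^sub>C y"
    and scaleC_add_left: "(c + d) *\<^sub>C x = c *\<^sub>C x + d *\<^sub>C x"
    and scaleC_scaleC: "c *\<^sub>C d *\<^sub>C x = (c * d) *\<^sub>C x"
    and scaleC_of_real: "complex_of_real r *\<^sub>C x = r *\<^sub>R x"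
    and norm_scaleC: "norm (c *\<^sub>C x) = norm c * norm x"

class complex_banach = complex_normed_vector + banach

instantiation complex :: complex_banach
begin

definition scaleC_complex :: "complex \<Rightarrow> complex \<Rightarrow> complex"
  where "scaleC_complex c z = c * z"

instance
  by standard (simp_all add: scaleC_complex_def algebra_simps norm_mult scaleR_conv_of_real)

end

definition complex_linear :: "('a::complex_normed_vector \<Rightarrow> 'b::complex_normed_vector) \<Rightarrow> bool"
  where "complex_linear f \<longleftrightarrow>
    (\<forall>x y. f (x + y) = f x + f y) \<and> (\<forall>c x. f (c *\<^sub>C x) = c *\<^sub>C f x)"

section \<open>Bounded holomorphic functions on the open unit ball\<close>

text \<open>Holomorphic means Frechet differentiable with complex-linear derivative.\<close>

definition holomorphic_on_unit_ball :: "('e::complex_normed_vector \<Rightarrow> complex) \<Rightarrow> bool"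
  where "holomorphic_on_unit_ball f \<longleftrightarrow>
    (\<forall>x\<in>ball 0 1. \<exists>f'. complex_linear f' \<and> (f has_derivative f') (at x))"

text \<open>A function on the ball is represented by its extension by \<open>0\<close> to the whole space.\<close>

typedef (overloaded) 'e hinf =
  "{f :: 'e::complex_normed_vector \<Rightarrow> complex.
      holomorphic_on_unit_ball f \<and> bounded (f ` ball 0 1) \<and> (\<forall>x. x \<notin> ball 0 1 \<longrightarrow> f x = 0)}"
  morphisms apply_hinf Abs_hinf
proof
  show "(\<lambda>_. 0) \<in> {f :: 'e \<Rightarrow> complex.
      holomorphic_on_unit_ball f \<and> bounded (f ` ball 0 1) \<and> (\<forall>x. x \<notin> ball 0 1 \<longrightarrow> f x = 0)}"
    by (auto simp: holomorphic_on_unit_ball_def complex_linear_def scaleC_complex_def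
        bounded_iff intro!: exI[of _ "\<lambda>_. 0"])
qed

setup_lifting type_definition_hinf

lemma holomorphic_on_unit_ball_0: "holomorphic_on_unit_ball (\<lambda>_. 0)"
  by (auto simp: holomorphic_on_unit_ball_def complex_linear_def scaleC_complex_def
      intro!: exI[of _ "\<lambda>_. 0"])

lemma holomorphic_on_unit_ball_add:
  assumes "holomorphic_on_unit_ball f" "holomorphic_on_unit_ball g"
  shows "holomorphic_on_unit_ball (\<lambda>x. f x + g x)"
  unfolding holomorphic_on_unit_ball_def
proof
  fix x :: 'a assume "x \<in> ball 0 1"
  then obtain f' g' where "complex_linear f'" "(f has_derivative f') (at x)"
    "complex_linear g'" "(g has_derivative g') (at x)"
    using assms unfolding holomorphic_on_unit_ball_def by blast
  then show "\<exists>h'. complex_linear h' \<and> ((\<lambda>x. f x + g x) has_derivative h') (at x)"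
    by (intro exI[of _ "\<lambda>v. f' v + g' v"])
      (auto simp: complex_linear_def scaleC_complex_def algebra_simps intro: has_derivative_add)
qed

lemma holomorphic_on_unit_ball_cmult:
  assumes "holomorphic_on_unit_ball f"
  shows "holomorphic_on_unit_ball (\<lambda>x. c * f x)"
  unfolding holomorphic_on_unit_ball_def
proof
  fix x :: 'a assume "x \<in> ball 0 1"
  then obtain f' where "complex_linear f'" "(f has_derivative f') (at x)"
    using assms unfolding holomorphic_on_unit_ball_def by blast
  then show "\<exists>h'. complex_linear h' \<and> ((\<lambda>x. c * f x) has_derivative h') (at x)"
    by (intro exI[of _ "\<lambda>v. c * f' v"])
      (auto simp: complex_linear_def scaleC_complex_def algebra_simps
        intro: has_derivative_mult_right)
qed

lemma bounded_image_add:
  fixes f g :: "'a \<Rightarrow> 'b::real_normed_vector"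
  assumes "bounded (f ` S)" "bounded (g ` S)"
  shows "bounded ((\<lambda>x. f x + g x) ` S)"
  using bounded_plus_comp[OF assms] .

lemma bounded_image_cmult:
  fixes f :: "'a \<Rightarrow> complex"
  assumes "bounded (f ` S)"
  shows "bounded ((\<lambda>x. c * f x) ` S)"
proof -
  from assms obtain B where "\<And>x. x \<in> S \<Longrightarrow> norm (f x) \<le> B"
    unfolding bounded_iff by blast
  then show ?thesis
    unfolding bounded_iff by (auto simp: norm_mult intro!: exI[of _ "norm c * B"] mult_left_mono)
qed

instantiation hinf :: (complex_normed_vector) complex_normed_vector
begin

lift_definition zero_hinf :: "'a hinf" is "\<lambda>_. 0"
  by (auto simp: holomorphic_on_unit_ball_0 bounded_iff)

lift_definition plus_hinf :: "'a hinf \<Rightarrow> 'a hinf \<Rightarrow> 'a hinf" is "\<lambda>f g x. f x + g x"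
  by (auto intro: holomorphic_on_unit_ball_add bounded_image_add)

lift_definition scaleC_hinf :: "complex \<Rightarrow> 'a hinf \<Rightarrow> 'a hinf" is "\<lambda>c f x. c * f x"
  by (auto intro: holomorphic_on_unit_ball_cmult bounded_image_cmult)

definition scaleR_hinf :: "real \<Rightarrow> 'a hinf \<Rightarrow> 'a hinf"
  where "scaleR_hinf r f = complex_of_real r *\<^sub>C f"

definition uminus_hinf :: "'a hinf \<Rightarrow> 'a hinf"
  where "uminus_hinf f = (- 1) *\<^sub>C f"

definition minus_hinf :: "'a hinf \<Rightarrow> 'a hinf \<Rightarrow> 'a hinf"
  where "minus_hinf f g = f + (- g)"

definition norm_hinf :: "'a hinf \<Rightarrow> real"
  where "norm_hinf f = (SUP x\<in>ball 0 1. norm (apply_hinf f x))"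

definition sgn_hinf :: "'a hinf \<Rightarrow> 'a hinf"
  where "sgn_hinf f = inverse (norm f) *\<^sub>R f"

definition dist_hinf :: "'a hinf \<Rightarrow> 'a hinf \<Rightarrow> real"
  where "dist_hinf f g = norm (f - g)"

definition uniformity_hinf :: "('a hinf \<times> 'a hinf) filter"
  where "uniformity_hinf = (INF e\<in>{0 <..}. principal {(f, g). dist f g < e})"

definition open_hinf :: "'a hinf set \<Rightarrow> bool"
  where "open_hinf S = (\<forall>f\<in>S. \<forall>\<^sub>F (f', g) in uniformity. f' = f \<longrightarrow> g \<in> S)"

lemma norm_apply_hinf_le:
  fixes f :: "'a hinf"
  shows "norm (apply_hinf f x) \<le> norm f"
proof -
  have b: "bounded (apply_hinf f ` ball 0 1)" and z: "x \<notin> ball 0 1 \<Longrightarrow> apply_hinf f x = 0" for x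
    using apply_hinf[of f] by auto
  have bdd: "bdd_above ((\<lambda>x. norm (apply_hinf f x)) ` ball 0 1)"
    using b by (auto simp: bounded_iff bdd_above_def)
  have le: "norm (apply_hinf f y) \<le> norm f" if "y \<in> ball 0 1" for y
    unfolding norm_hinf_def by (rule cSUP_upper[OF that bdd])
  have "0 \<le> norm f"
    using le[of 0] by (smt (verit) centre_in_ball norm_ge_zero)
  then show ?thesis
    using le z by (cases "x \<in> ball 0 1") auto
qed

lemma norm_hinf_le:
  fixes f :: "'a hinf"
  assumes "\<And>x. x \<in> ball 0 1 \<Longrightarrow> norm (apply_hinf f x) \<le> B"
  shows "norm f \<le> B"
  unfolding norm_hinf_def by (rule cSUP_least) (use assms in auto)

lemma norm_hinf_scaleC:
  fixes f :: "'a hinf"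
  shows "norm (c *\<^sub>C f) = norm c * norm f"
proof (rule antisym)
  have le: "norm (d *\<^sub>C g) \<le> norm d * norm g" for d and g :: "'a hinf"
    by (rule norm_hinf_le)
      (simp add: scaleC_hinf.rep_eq norm_mult mult_left_mono norm_apply_hinf_le)
  then show "norm (c *\<^sub>C f) \<le> norm c * norm f" .
  show "norm c * norm f \<le> norm (c *\<^sub>C f)"
  proof (cases "c = 0")
    case True
    then show ?thesis
      using norm_apply_hinf_le[of "c *\<^sub>C f" 0] by (smt (verit) mult_eq_0_iff norm_ge_zero norm_zero)
  next
    case False
    have "inverse c *\<^sub>C c *\<^sub>C f = f"
      by (rule apply_hinf_inject[THEN iffD1])
        (simp add: scaleC_hinf.rep_eq fun_eq_iff False flip: mult.assoc)
    then have "norm f \<le> norm (inverse c) * norm (c *\<^sub>C f)"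
      using le[of "inverse c" "c *\<^sub>C f"] by simp
    then show ?thesis
      using False by (simp add: norm_divide field_simps)
  qed
qed

instance
proof
  fix f g h :: "'a hinf" and a b :: real and c d :: complex
  show "f + g + h = f + (g + h)" by transfer (simp add: algebra_simps)
  show "f + g = g + f" by transfer (simp add: algebra_simps)
  show "0 + f = f" by transfer simp
  show "- f + f = 0" unfolding uminus_hinf_def by transfer simp
  show "f - g = f + - g" by (simp add: minus_hinf_def)
  show "a *\<^sub>R (f + g) = a *\<^sub>R f + a *\<^sub>R g"
    unfolding scaleR_hinf_def by transfer (simp add: algebra_simps)
  show "(a + b) *\<^sub>R f = a *\<^sub>R f + b *\<^sub>R f"
    unfolding scaleR_hinf_def by transfer (simp add: algebra_simps)
  show "a *\<^sub>R b *\<^sub>R f = (a * b) *\<^sub>R f"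
    unfolding scaleR_hinf_def by transfer (simp add: algebra_simps)
  show "1 *\<^sub>R f = f"
    unfolding scaleR_hinf_def by transfer simp
  show "dist f g = norm (f - g)" by (rule dist_hinf_def)
  show "sgn f = inverse (norm f) *\<^sub>R f" by (rule sgn_hinf_def)
  show "(uniformity :: ('a hinf \<times> 'a hinf) filter) = (INF e\<in>{0 <..}. principal {(f, g). dist f g < e})"
    by (rule uniformity_hinf_def)
  show "open U = (\<forall>f\<in>U. \<forall>\<^sub>F (f', g) in uniformity. f' = f \<longrightarrow> g \<in> U)" for U :: "'a hinf set"
    by (rule open_hinf_def)
  show "norm f = 0 \<longleftrightarrow> f = 0"
  proof
    assume "norm f = 0"
    then have "apply_hinf f x = 0" for x
      using norm_apply_hinf_le[of f x] by simp
    then show "f = 0" by transfer auto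
  next
    assume "f = 0"
    then show "norm f = 0" by (simp add: norm_hinf_def zero_hinf.rep_eq)
  qed
  show "norm (f + g) \<le> norm f + norm g"
    by (rule norm_hinf_le)
      (simp add: plus_hinf.rep_eq norm_triangle_mono norm_apply_hinf_le)
  show "norm (a *\<^sub>R f) = \<bar>a\<bar> * norm f"
    by (simp add: scaleR_hinf_def norm_hinf_scaleC)
  show "c *\<^sub>C (f + g) = c *\<^sub>C f + c *\<^sub>C g" by transfer (simp add: algebra_simps)
  show "(c + d) *\<^sub>C f = c *\<^sub>C f + d *\<^sub>C f" by transfer (simp add: algebra_simps)
  show "c *\<^sub>C d *\<^sub>C f = (c * d) *\<^sub>C f" by transfer (simp add: algebra_simps)
  show "complex_of_real a *\<^sub>C f = a *\<^sub>R f" by (simp add: scaleR_hinf_def)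
  show "norm (c *\<^sub>C f) = norm c * norm f" by (rule norm_hinf_scaleC)
qed

end

definition compact_open_topology :: "'e::complex_normed_vector hinf topology"
  where "compact_open_topology =
    topology_generated_by
      {{f. apply_hinf f ` K \<subseteq> U} | K U. compact K \<and> K \<subseteq> ball 0 1 \<and> open U}"

section \<open>Mujica's predual\<close>

text \<open>
  The complex dual of \<open>X\<close> consists of the complex-linear members of the real Banach space
  \<open>X \<Rightarrow>\<^sub>L complex\<close> of bounded real-linear maps; its norm is the operator norm, which does not depend
  on the scalar field.
\<close>

typedef (overloaded) 'e ginf =
  "{\<phi> :: 'e::complex_normed_vector hinf \<Rightarrow>\<^sub>L complex.
      complex_linear (blinfun_apply \<phi>) \<and>
      continuous_map (subtopology compact_open_topology (cball 0 1)) euclidean (blinfun_apply \<phi>)}"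
  morphisms functional_of_ginf Abs_ginf
  by (intro exI[of _ 0]) (auto simp: complex_linear_def zero_blinfun.rep_eq scaleC_complex_def)

setup_lifting type_definition_ginf

lift_definition cmult_blinfun :: "complex \<Rightarrow> ('a::real_normed_vector \<Rightarrow>\<^sub>L complex) \<Rightarrow> ('a \<Rightarrow>\<^sub>L complex)"
  is "\<lambda>c \<phi> x. c * \<phi> x"
  by (intro bounded_linear_const_mult)

lemma continuous_map_cmult:
  fixes f :: "'a \<Rightarrow> complex"
  assumes "continuous_map T euclidean f"
  shows "continuous_map T euclidean (\<lambda>x. c * f x)"
proof -
  have "continuous_map T euclidean ((\<lambda>z. c * z) \<circ> f)"
    by (rule continuous_map_compose[OF assms]) (auto intro!: continuous_intros)
  then show ?thesis by (simp add: o_def)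
qed

instantiation ginf :: (complex_normed_vector) complex_normed_vector
begin

lift_definition zero_ginf :: "'a ginf" is 0
  by (auto simp: complex_linear_def zero_blinfun.rep_eq scaleC_complex_def)

lift_definition plus_ginf :: "'a ginf \<Rightarrow> 'a ginf \<Rightarrow> 'a ginf" is "(+)"
  by (auto simp: complex_linear_def plus_blinfun.rep_eq scaleC_complex_def algebra_simps
      intro: continuous_map_add)

lift_definition scaleC_ginf :: "complex \<Rightarrow> 'a ginf \<Rightarrow> 'a ginf" is cmult_blinfun
  by (auto simp: complex_linear_def cmult_blinfun.rep_eq scaleC_complex_def algebra_simps
      intro: continuous_map_cmult)

lift_definition norm_ginf :: "'a ginf \<Rightarrow> real" is norm .

definition scaleR_ginf :: "real \<Rightarrow> 'a ginf \<Rightarrow> 'a ginf"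
  where "scaleR_ginf r \<phi> = complex_of_real r *\<^sub>C \<phi>"

definition uminus_ginf :: "'a ginf \<Rightarrow> 'a ginf"
  where "uminus_ginf \<phi> = (- 1) *\<^sub>C \<phi>"

definition minus_ginf :: "'a ginf \<Rightarrow> 'a ginf \<Rightarrow> 'a ginf"
  where "minus_ginf \<phi> \<psi> = \<phi> + (- \<psi>)"

definition sgn_ginf :: "'a ginf \<Rightarrow> 'a ginf"
  where "sgn_ginf \<phi> = inverse (norm \<phi>) *\<^sub>R \<phi>"

definition dist_ginf :: "'a ginf \<Rightarrow> 'a ginf \<Rightarrow> real"
  where "dist_ginf \<phi> \<psi> = norm (\<phi> - \<psi>)"

definition uniformity_ginf :: "('a ginf \<times> 'a ginf) filter"
  where "uniformity_ginf = (INF e\<in>{0 <..}. principal {(\<phi>, \<psi>). dist \<phi> \<psi> < e})"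

definition open_ginf :: "'a ginf set \<Rightarrow> bool"
  where "open_ginf S = (\<forall>\<phi>\<in>S. \<forall>\<^sub>F (\<phi>', \<psi>) in uniformity. \<phi>' = \<phi> \<longrightarrow> \<psi> \<in> S)"

lemma cmult_blinfun_of_real: "cmult_blinfun (complex_of_real r) \<phi> = r *\<^sub>R \<phi>"
  by (rule blinfun_eqI) (simp add: cmult_blinfun.rep_eq scaleR_blinfun.rep_eq scaleR_conv_of_real)

lemma norm_cmult_blinfun: "norm (cmult_blinfun c \<phi>) = norm c * norm \<phi>"
proof (rule antisym)
  have le: "norm (cmult_blinfun d \<psi>) \<le> norm d * norm \<psi>" for d and \<psi> :: "'b::real_normed_vector \<Rightarrow>\<^sub>L complex"
    by (rule norm_blinfun_bound)
      (auto simp: cmult_blinfun.rep_eq norm_mult mult.assoc intro!: mult_left_mono norm_blinfun)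
  then show "norm (cmult_blinfun c \<phi>) \<le> norm c * norm \<phi>" .
  show "norm c * norm \<phi> \<le> norm (cmult_blinfun c \<phi>)"
  proof (cases "c = 0")
    case False
    have "cmult_blinfun (inverse c) (cmult_blinfun c \<phi>) = \<phi>"
      by (rule blinfun_eqI) (use False in \<open>simp add: cmult_blinfun.rep_eq\<close>)
    then have "norm \<phi> \<le> norm (inverse c) * norm (cmult_blinfun c \<phi>)"
      using le[of "inverse c" "cmult_blinfun c \<phi>"] by simp
    then show ?thesis
      using False by (simp add: norm_divide field_simps)
  qed simp
qed

instance
proof
  fix f g h :: "'a ginf" and a b :: real and c d :: complex
  show "f + g + h = f + (g + h)" by transfer (simp add: algebra_simps)
  show "f + g = g + f" by transfer (simp add: algebra_simps)
  show "0 + f = f" by transfer simp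
  show "- f + f = 0" unfolding uminus_ginf_def
    by transfer (rule blinfun_eqI, simp add: cmult_blinfun.rep_eq blinfun.bilinear_simps)
  show "f - g = f + - g" by (simp add: minus_ginf_def)
  show "a *\<^sub>R (f + g) = a *\<^sub>R f + a *\<^sub>R g"
    unfolding scaleR_ginf_def by transfer (simp add: cmult_blinfun_of_real algebra_simps)
  show "(a + b) *\<^sub>R f = a *\<^sub>R f + b *\<^sub>R f"
    unfolding scaleR_ginf_def by transfer (simp only: cmult_blinfun_of_real scaleR_add_left)
  show "a *\<^sub>R b *\<^sub>R f = (a * b) *\<^sub>R f"
    unfolding scaleR_ginf_def by transfer (simp only: cmult_blinfun_of_real scaleR_scaleR)
  show "1 *\<^sub>R f = f"
    unfolding scaleR_ginf_def by transfer (simp only: cmult_blinfun_of_real scaleR_one)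
  show "dist f g = norm (f - g)" by (rule dist_ginf_def)
  show "sgn f = inverse (norm f) *\<^sub>R f" by (rule sgn_ginf_def)
  show "(uniformity :: ('a ginf \<times> 'a ginf) filter) = (INF e\<in>{0 <..}. principal {(f, g). dist f g < e})"
    by (rule uniformity_ginf_def)
  show "open U = (\<forall>f\<in>U. \<forall>\<^sub>F (f', g) in uniformity. f' = f \<longrightarrow> g \<in> U)" for U :: "'a ginf set"
    by (rule open_ginf_def)
  show "norm f = 0 \<longleftrightarrow> f = 0" by transfer simp
  show "norm (f + g) \<le> norm f + norm g" by transfer (rule norm_triangle_ineq)
  show "norm (a *\<^sub>R f) = \<bar>a\<bar> * norm f"
    unfolding scaleR_ginf_def by transfer (simp add: norm_cmult_blinfun)
  show "c *\<^sub>C (f + g) = c *\<^sub>C f + c *\<^sub>C g"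
    by transfer (rule blinfun_eqI, simp add: cmult_blinfun.rep_eq blinfun.bilinear_simps algebra_simps)
  show "(c + d) *\<^sub>C f = c *\<^sub>C f + d *\<^sub>C f"
    by transfer (rule blinfun_eqI, simp add: cmult_blinfun.rep_eq blinfun.bilinear_simps algebra_simps)
  show "c *\<^sub>C d *\<^sub>C f = (c * d) *\<^sub>C f"
    by transfer (rule blinfun_eqI, simp add: cmult_blinfun.rep_eq algebra_simps)
  show "complex_of_real a *\<^sub>C f = a *\<^sub>R f" by (simp add: scaleR_ginf_def)
  show "norm (c *\<^sub>C f) = norm c * norm f" by transfer (rule norm_cmult_blinfun)
qed

end

lemma dist_functional_of_ginf: "dist (functional_of_ginf \<phi>) (functional_of_ginf \<psi>) = dist \<phi> \<psi>"
proof -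
  have "functional_of_ginf (\<phi> - \<psi>) = functional_of_ginf \<phi> - functional_of_ginf \<psi>"
    unfolding minus_ginf_def uminus_ginf_def
    by transfer (rule blinfun_eqI, simp add: cmult_blinfun.rep_eq blinfun.bilinear_simps)
  then show ?thesis
    by (simp add: dist_norm norm_ginf.rep_eq)
qed

instance ginf :: (complex_normed_vector) complex_banach
proof
  fix X :: "nat \<Rightarrow> 'a ginf"
  let ?Y = "\<lambda>n. functional_of_ginf (X n)"
  let ?T = "subtopology compact_open_topology (cball 0 1) :: 'a hinf topology"
  assume "Cauchy X"
  then have "Cauchy ?Y"
    by (simp add: Cauchy_def dist_functional_of_ginf)
  then obtain L where L: "?Y \<longlonglongrightarrow> L"
    using Cauchy_convergent_iff convergent_def by blast
  have lim: "(\<lambda>n. ?Y n f) \<longlonglongrightarrow> L f" for f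
    by (intro tendsto_intros L)
  have lin: "complex_linear (blinfun_apply (?Y n))"
    and cont: "continuous_map ?T euclidean (blinfun_apply (?Y n))" for n
    using functional_of_ginf[of "X n"] by auto
  have "complex_linear (blinfun_apply L)"
    unfolding complex_linear_def
  proof (intro conjI allI)
    show "blinfun_apply L (x + y) = blinfun_apply L x + blinfun_apply L y" for x y
      by (simp add: blinfun.bilinear_simps)
    show "blinfun_apply L (c *\<^sub>C x) = c *\<^sub>C blinfun_apply L x" for c x
    proof (rule LIMSEQ_unique[OF lim])
      have "(\<lambda>n. c * ?Y n x) \<longlonglongrightarrow> c * L x"
        by (intro tendsto_intros lim)
      then show "(\<lambda>n. ?Y n (c *\<^sub>C x)) \<longlonglongrightarrow> c *\<^sub>C L x"
        using lin by (simp add: complex_linear_def scaleC_complex_def)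
    qed
  qed
  moreover have "continuous_map ?T Met_TC.mtopology (blinfun_apply L)"
  proof (rule Met_TC.continuous_map_uniform_limit_alt[where F = sequentially and f = "\<lambda>n. blinfun_apply (?Y n)"])
    show "\<forall>\<^sub>F n in sequentially. continuous_map ?T Met_TC.mtopology (blinfun_apply (?Y n))"
      using cont by simp
    show "blinfun_apply L \<in> topspace ?T \<rightarrow> UNIV" by simp
    show "\<forall>\<^sub>F n in sequentially. \<forall>f\<in>topspace ?T.
        dist (blinfun_apply (?Y n) f) (blinfun_apply L f) < e" if "0 < e" for e
    proof -
      have "\<forall>\<^sub>F n in sequentially. dist (?Y n) L < e"
        using L that by (rule tendstoD)
      then show ?thesis
      proof eventually_elim
        case (elim n)
        show ?case
        proof
          fix f assume "f \<in> topspace ?T"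
          then have "norm f \<le> 1" by simp
          have "dist (?Y n f) (L f) = norm ((?Y n - L) f)"
            by (simp add: dist_norm blinfun.bilinear_simps)
          also have "\<dots> \<le> norm (?Y n - L) * norm f"
            by (rule norm_blinfun)
          also have "\<dots> \<le> norm (?Y n - L) * 1"
            using \<open>norm f \<le> 1\<close> by (intro mult_left_mono) auto
          finally show "dist (blinfun_apply (?Y n) f) (blinfun_apply L f) < e"
            using elim by (simp add: dist_norm)
        qed
      qed
    qed
  qed simp
  ultimately have "functional_of_ginf (Abs_ginf L) = L"
    by (intro Abs_ginf_inverse) simp
  then have "X \<longlonglongrightarrow> Abs_ginf L"
    using L by (simp add: tendsto_iff flip: dist_functional_of_ginf)
  then show "convergent X"
    by (auto simp: convergent_def)
qed

section \<open>Strongly exposed points and the Radon--Nikodym property\<close>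

definition strongly_exposed :: "'a::complex_normed_vector \<Rightarrow> bool"
  where "strongly_exposed x \<longleftrightarrow> norm x = 1 \<and>
    (\<exists>\<xi> :: 'a \<Rightarrow>\<^sub>L complex. complex_linear (blinfun_apply \<xi>) \<and> norm \<xi> = 1 \<and> \<xi> x = 1 \<and>
      (\<forall>u :: nat \<Rightarrow> 'a. (\<forall>n. u n \<in> ball 0 1) \<and> (\<lambda>n. Re (\<xi> (u n))) \<longlonglongrightarrow> 1 \<longrightarrow> u \<longlonglongrightarrow> x))"

text \<open>
  The same notion relative to an arbitrary set, which for the closed unit ball of a nonzero space
  reduces to the previous one. The functional may be zero, so that the point of a singleton is strongly exposed;
  if \<open>C\<close> has at least two points, the convergence condition excludes the zero functional.
\<close>

definition strongly_exposed_points :: "'a::complex_normed_vector set \<Rightarrow> 'a set"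
  where "strongly_exposed_points C = {x \<in> C.
    \<exists>\<xi> :: 'a \<Rightarrow>\<^sub>L complex. complex_linear (blinfun_apply \<xi>) \<and> (\<forall>y\<in>C. Re (\<xi> y) \<le> Re (\<xi> x)) \<and>
      (\<forall>u :: nat \<Rightarrow> 'a. (\<forall>n. u n \<in> C) \<and> (\<lambda>n. Re (\<xi> (u n))) \<longlonglongrightarrow> Re (\<xi> x) \<longrightarrow> u \<longlonglongrightarrow> x)}"

text \<open>
  The geometric form of the property: every bounded closed convex set is the closed convex hull of
  its strongly exposed points.
\<close>

definition radon_nikodym_property :: "'a::complex_banach itself \<Rightarrow> bool"
  where "radon_nikodym_property _ \<longleftrightarrow>
    (\<forall>C :: 'a set. bounded C \<and> closed C \<and> convex C \<longrightarrow>
      C = closure (convex hull strongly_exposed_points C))"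

end

theory Submission
  imports Defs "HOL-Complex_Analysis.Riemann_Mapping"
begin

text \<open>
  A strongly exposing functional \<open>\<xi>\<close> on \<open>G = G\<^sup>\<infinity>(E)\<close> would force any two sequences in the ball of
  \<open>G\<close> along which \<open>Re \<xi>\<close> tends to \<open>\<parallel>\<xi>\<parallel>\<close> to have the same limit. Two such sequences that stay
  apart can be found among the multiples of point evaluations \<open>\<delta>\<^sub>x\<close>.

  The first ingredient is that \<open>\<parallel>\<xi>\<parallel>\<close> is the supremum of \<open>\<bar>\<xi> \<delta>\<^sub>x\<bar>\<close>. The function
  \<open>f x = \<xi> \<delta>\<^sub>x\<close> is bounded and holomorphic, because \<open>x \<mapsto> \<delta>\<^sub>x\<close> is differentiable in the norm of
  \<open>G\<close>; so \<open>f\<close> is an element of \<open>H\<^sup>\<infinity>\<close>, and \<open>\<phi> \<mapsto> \<phi> f\<close> agrees with \<open>\<xi>\<close> on point evaluations. These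
  span a dense subspace of \<open>G\<close> (lemma \<open>span_point_evals_dense\<close>): continuity of \<open>\<phi>\<close> for the
  compact-open topology and equicontinuity of the unit ball of \<open>H\<^sup>\<infinity>\<close> give a finite set \<open>F\<close> such that
  \<open>\<phi>\<close> is small on the functions vanishing on \<open>F\<close>, and by the Hahn--Banach theorem \<open>\<phi>\<close> is then close
  to a combination of the evaluations at \<open>F\<close>. Hence \<open>\<xi> \<phi> = \<phi> f\<close> for all \<open>\<phi>\<close> (lemma
  \<open>dual_of_ginf_is_hinf\<close>).

  The second ingredient is the Schwarz--Pick inequality. If \<open>\<bar>f x\<bar>\<close> is close to \<open>\<parallel>f\<parallel>\<close>, then \<open>f\<close> is
  almost constant on points at bounded pseudohyperbolic distance from \<open>x\<close>, measured in a complex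
  disc through \<open>0\<close> and \<open>x\<close>. But the evaluation at a point \<open>y\<close> of this disc at distance \<open>1/2\<close> from \<open>x\<close>
  differs from \<open>\<delta>\<^sub>x\<close> by at least \<open>1/2\<close> in norm, as a norming functional for the disc followed by a
  Moebius transformation shows (lemma \<open>separated_point_of_almost_equal_value\<close>). The evaluations at
  \<open>x\<close> and \<open>y\<close>, multiplied by a common phase, give the two sequences.

  The Radon--Nikodym property fails because the closed unit ball of \<open>G\<close>, a bounded closed convex
  set, would have to be the closed convex hull of the empty set.
\<close>

section \<open>The Hahn--Banach theorem\<close>

definition sublinear :: "('a::real_vector \<Rightarrow> real) \<Rightarrow> bool"
  where "sublinear p \<longleftrightarrow> (\<forall>x y. p (x + y) \<le> p x + p y) \<and> (\<forall>r x. 0 < r \<longrightarrow> p (r *\<^sub>R x) = r * p x)"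

lemma sublinearI:
  assumes "\<And>x y. p (x + y) \<le> p x + p y"
    and "\<And>r x. 0 < r \<Longrightarrow> p (r *\<^sub>R x) \<le> r * p x"
  shows "sublinear p"
  unfolding sublinear_def
proof (intro conjI allI impI assms antisym)
  fix r :: real and x assume "0 < r"
  then have "p (inverse r *\<^sub>R r *\<^sub>R x) \<le> inverse r * p (r *\<^sub>R x)"
    by (intro assms) simp
  with \<open>0 < r\<close> show "r * p x \<le> p (r *\<^sub>R x)"
    by (simp add: field_simps)
qed

lemma sublinear_0: "sublinear p \<Longrightarrow> p 0 = 0"
proof -
  assume "sublinear p"
  then have "p (2 *\<^sub>R 0) = 2 * p 0"
    unfolding sublinear_def by (meson zero_less_numeral)
  then show ?thesis by simp
qed

lemma sublinear_add_le: "sublinear p \<Longrightarrow> p (x + y) \<le> p x + p y"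
  by (simp add: sublinear_def)

lemma sublinear_scaleR: "sublinear p \<Longrightarrow> 0 \<le> r \<Longrightarrow> p (r *\<^sub>R x) = r * p x"
  using sublinear_0[of p] by (cases "r = 0") (auto simp: sublinear_def)

lemma sublinear_neg_le: "sublinear p \<Longrightarrow> - p (- x) \<le> p x"
  using sublinear_add_le[of p x "- x"] sublinear_0[of p] by simp

text \<open>
  The minorant is \<open>q x = inf {p (x + n) - u n | n \<in> C}\<close>, finite because
  \<open>u \<le> p\<close> on \<open>C\<close> bounds every term from below by \<open>- p (- x)\<close>. The construction serves twice:
  on a ray it shows that minimal sublinear functionals are linear, on a subspace it forces
  the linear functional to agree with the given one.
\<close>

lemma sublinear_minorant_on_cone:
  fixes p :: "'a::real_vector \<Rightarrow> real"
  assumes p: "sublinear p"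
    and C0: "0 \<in> C" and Cadd: "\<And>m n. m \<in> C \<Longrightarrow> n \<in> C \<Longrightarrow> m + n \<in> C"
    and Cscale: "\<And>r n. 0 < r \<Longrightarrow> n \<in> C \<Longrightarrow> r *\<^sub>R n \<in> C"
    and u0: "u 0 = 0" and uadd: "\<And>m n. m \<in> C \<Longrightarrow> n \<in> C \<Longrightarrow> u (m + n) = u m + u n"
    and uscale: "\<And>r n. 0 < r \<Longrightarrow> n \<in> C \<Longrightarrow> u (r *\<^sub>R n) = r * u n"
    and le: "\<And>n. n \<in> C \<Longrightarrow> u n \<le> p n"
  obtains q where "sublinear q" "\<And>x. q x \<le> p x" "\<And>n. n \<in> C \<Longrightarrow> q (- n) \<le> - u n"
proof
  define q where "q x = (INF n\<in>C. p (x + n) - u n)" for x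
  have "- p (- x) \<le> p (x + n) - u n" if "n \<in> C" for x n
    using sublinear_add_le[OF p, of "x + n" "- x"] le[OF that] by simp
  then have bdd: "bdd_below ((\<lambda>n. p (x + n) - u n) ` C)" for x
    by (auto intro!: bdd_belowI2)
  have q_le: "q x \<le> p (x + n) - u n" if "n \<in> C" for x n
    unfolding q_def by (rule cINF_lower[OF bdd that])
  have q_greatest: "a \<le> q x" if "\<And>n. n \<in> C \<Longrightarrow> a \<le> p (x + n) - u n" for a x
    unfolding q_def using C0 that by (intro cINF_greatest) auto
  show "q x \<le> p x" for x
    using q_le[OF C0, of x] u0 by simp
  show "q (- n) \<le> - u n" if "n \<in> C" for n
    using q_le[OF that, of "- n"] sublinear_0[OF p] by simp
  show "sublinear q"
  proof (rule sublinearI)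
    fix x y
    have "q (x + y) - (p (x + m) - u m) \<le> p (y + n) - u n" if "m \<in> C" "n \<in> C" for m n
      using q_le[OF Cadd[OF that], of "x + y"] sublinear_add_le[OF p, of "x + m" "y + n"] uadd[OF that]
      by (simp add: algebra_simps)
    then have "q (x + y) - (p (x + m) - u m) \<le> q y" if "m \<in> C" for m
      using that by (intro q_greatest)
    then have "q (x + y) - q y \<le> q x"
      by (intro q_greatest) (smt (verit))
    then show "q (x + y) \<le> q x + q y" by simp
  next
    fix r :: real and x assume r: "0 < r"
    have "inverse r * q (r *\<^sub>R x) \<le> p (x + n) - u n" if "n \<in> C" for n
    proof -
      have "q (r *\<^sub>R x) \<le> p (r *\<^sub>R x + r *\<^sub>R n) - u (r *\<^sub>R n)"
        by (intro q_le Cscale r that)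
      also have "\<dots> = r * (p (x + n) - u n)"
        using sublinear_scaleR[OF p, of r "x + n"] r uscale[OF r that]
        by (simp add: algebra_simps)
      finally show ?thesis
        using r by (simp add: field_simps)
    qed
    then have "inverse r * q (r *\<^sub>R x) \<le> q x"
      by (rule q_greatest)
    then show "q (r *\<^sub>R x) \<le> r * q x"
      using r by (simp add: field_simps)
  qed
qed

text \<open>
  Apply the previous lemma with \<open>u = m\<close> on the ray through \<open>y\<close>. By minimality the minorant is
  \<open>m\<close> itself, so \<open>m (- y) \<le> - m y\<close>; subadditivity gives the other inequality, and a
  subadditive odd functional is additive.
\<close>

lemma minimal_sublinear_linear:
  fixes m :: "'a::real_vector \<Rightarrow> real"
  assumes m: "sublinear m"
    and minimal: "\<And>q. sublinear q \<Longrightarrow> (\<And>x. q x \<le> m x) \<Longrightarrow> q = m"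
  shows "linear m"
proof -
  have neg: "m (- y) = - m y" for y
  proof (rule antisym)
    let ?C = "(\<lambda>t. t *\<^sub>R y) ` {0..}"
    have C: "s *\<^sub>R y \<in> ?C" if "0 \<le> s" for s
      using that by auto
    obtain q where q: "sublinear q" "\<And>x. q x \<le> m x" "\<And>n. n \<in> ?C \<Longrightarrow> q (- n) \<le> - m n"
    proof (rule sublinear_minorant_on_cone[OF m, of ?C m])
      show "0 \<in> ?C" using C[of 0] by simp
      show "a + b \<in> ?C" if "a \<in> ?C" "b \<in> ?C" for a b
        using that C by (auto simp flip: scaleR_add_left)
      show "r *\<^sub>R n \<in> ?C" if "0 < r" "n \<in> ?C" for r n
        using that C by auto
      show "m 0 = 0" by (rule sublinear_0[OF m])
      show "m (a + b) = m a + m b" if "a \<in> ?C" "b \<in> ?C" for a b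
        using that sublinear_scaleR[OF m] by (auto simp: distrib_right simp flip: scaleR_add_left)
      show "m (r *\<^sub>R n) = r * m n" if "0 < r" "n \<in> ?C" for r n
        using that sublinear_scaleR[OF m] by simp
    qed auto
    from minimal[OF q(1,2)] q(3)[OF C[of 1]] show "m (- y) \<le> - m y"
      by simp
    show "- m y \<le> m (- y)"
      using sublinear_neg_le[OF m, of "- y"] by simp
  qed
  have "m (x + y) = m x + m y" for x y
    using sublinear_add_le[OF m, of x y] sublinear_add_le[OF m, of "x + y" "- y"] neg[of y] by simp
  moreover have "m (r *\<^sub>R x) = r * m x" for r x
  proof (cases "0 \<le> r")
    case False
    then have "m ((- r) *\<^sub>R x) = (- r) * m x"
      by (intro sublinear_scaleR m) simp
    then show ?thesis using neg[of "r *\<^sub>R x"] by simp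
  qed (rule sublinear_scaleR[OF m])
  ultimately show ?thesis by (auto intro: linearI)
qed

text \<open>
  Zorn's lemma in the reversed pointwise order: a chain of sublinear functionals below \<open>p\<close> has
  its pointwise infimum as a bound, finite since all its members are at least \<open>- p (- x)\<close> at
  \<open>x\<close>, and a minimal element is linear.
\<close>

lemma linear_below_sublinear:
  fixes p :: "'a::real_vector \<Rightarrow> real"
  assumes p: "sublinear p"
  obtains m where "linear m" "\<And>x. m x \<le> p x"
proof -
  let ?A = "{q. sublinear q \<and> (\<forall>x. q x \<le> p x)}"
  let ?P = "\<lambda>f g :: 'a \<Rightarrow> real. \<forall>x. g x \<le> f x"
  have "\<exists>m\<in>?A. \<forall>q\<in>?A. ?P m q \<longrightarrow> q = m"
  proof (rule predicate_Zorn)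
    show "partial_order_on ?A (relation_of ?P ?A)"
      by (rule partial_order_on_relation_ofI) (auto intro: order_trans antisym simp: fun_eq_iff)
    fix C assume "C \<in> Chains (relation_of ?P ?A)"
    then have sub: "C \<subseteq> ?A" and chain: "\<And>f g. f \<in> C \<Longrightarrow> g \<in> C \<Longrightarrow> ?P f g \<or> ?P g f"
      by (auto simp: Chains_def relation_of_def)
    show "\<exists>i\<in>?A. \<forall>q\<in>C. ?P q i"
    proof (cases "C = {}")
      case True
      then show ?thesis using p by auto
    next
      case False
      define i where "i x = (INF q\<in>C. q x)" for x
      have lower: "- p (- x) \<le> q x" if "q \<in> C" for q x
      proof -
        from that sub have "sublinear q" "q (- x) \<le> p (- x)" by auto
        then show ?thesis using sublinear_neg_le[of q x] by linarith
      qed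
      then have bdd: "bdd_below ((\<lambda>q. q x) ` C)" for x
        by (auto intro!: bdd_belowI2)
      have i_le: "i x \<le> q x" if "q \<in> C" for q x
        unfolding i_def by (rule cINF_lower[OF bdd that])
      have i_greatest: "a \<le> i x" if "\<And>q. q \<in> C \<Longrightarrow> a \<le> q x" for a x
        unfolding i_def using False that by (intro cINF_greatest) auto
      have "sublinear i"
      proof (rule sublinearI)
        fix x y
        have "i (x + y) - f x \<le> g y" if fg: "f \<in> C" "g \<in> C" for f g
        proof -
          from chain[OF fg] fg obtain h where h: "h \<in> C" "h x \<le> f x" "h y \<le> g y"
            by blast
          with sub have "h (x + y) \<le> h x + h y"
            by (auto intro: sublinear_add_le)
          with h i_le[OF h(1), of "x + y"] show ?thesis by linarith
        qed
        then have "i (x + y) - f x \<le> i y" if "f \<in> C" for f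
          using that by (intro i_greatest)
        then have "i (x + y) - i y \<le> i x"
          by (intro i_greatest) (smt (verit))
        then show "i (x + y) \<le> i x + i y" by simp
      next
        fix r :: real and x assume r: "0 < r"
        have "inverse r * i (r *\<^sub>R x) \<le> q x" if "q \<in> C" for q
        proof -
          have "q (r *\<^sub>R x) = r * q x"
            using sub that r by (auto intro: sublinear_scaleR)
          then show ?thesis
            using i_le[OF that, of "r *\<^sub>R x"] r by (simp add: field_simps)
        qed
        then have "inverse r * i (r *\<^sub>R x) \<le> i x"
          by (rule i_greatest)
        then show "i (r *\<^sub>R x) \<le> r * i x"
          using r by (simp add: field_simps)
      qed
      moreover have "i x \<le> p x" for x
      proof -
        from False obtain q where "q \<in> C" by blast
        with sub have "q x \<le> p x" by auto
        with i_le[OF \<open>q \<in> C\<close>, of x] show ?thesis by linarith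
      qed
      ultimately show ?thesis using i_le by blast
    qed
  qed
  then obtain m where m: "sublinear m" "\<And>x. m x \<le> p x"
    and min: "\<And>q. sublinear q \<Longrightarrow> (\<And>x. q x \<le> p x) \<Longrightarrow> (\<And>x. q x \<le> m x) \<Longrightarrow> q = m"
    by blast
  have "linear m"
    using m(1) by (rule minimal_sublinear_linear) (meson m(2) min order_trans)
  then show ?thesis using m(2) that by blast
qed

text \<open>
  First lower \<open>p\<close> to a sublinear \<open>q\<close> with \<open>q (- n) \<le> - u n\<close> on \<open>S\<close>. Every linear functional
  below \<open>q\<close> is then at least \<open>u\<close> on \<open>S\<close>, hence equal to it because \<open>S\<close> is symmetric.
\<close>

lemma hahn_banach_real:
  fixes p :: "'a::real_vector \<Rightarrow> real"
  assumes p: "sublinear p" and S: "subspace S"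
    and uadd: "\<And>x y. x \<in> S \<Longrightarrow> y \<in> S \<Longrightarrow> u (x + y) = u x + u y"
    and uscale: "\<And>r x. x \<in> S \<Longrightarrow> u (r *\<^sub>R x) = r * u x"
    and le: "\<And>x. x \<in> S \<Longrightarrow> u x \<le> p x"
  obtains m where "linear m" "\<And>x. m x \<le> p x" "\<And>x. x \<in> S \<Longrightarrow> m x = u x"
proof -
  obtain q where q: "sublinear q" "\<And>x. q x \<le> p x" "\<And>n. n \<in> S \<Longrightarrow> q (- n) \<le> - u n"
  proof (rule sublinear_minorant_on_cone[OF p, of S u])
    show "u 0 = 0"
      using uscale[of 0 0] subspace_0[OF S] by simp
  qed (use S uadd uscale le in \<open>auto simp: subspace_0 subspace_add subspace_scale\<close>)
  obtain m where m: "linear m" "\<And>x. m x \<le> q x"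
    using linear_below_sublinear[OF q(1)] by blast
  have ge: "u x \<le> m x" if "x \<in> S" for x
    using q(3)[OF that] m(2)[of "- x"] linear_neg[OF m(1), of x] by linarith
  have "m x = u x" if "x \<in> S" for x
  proof -
    have "u (- x) = - u x"
      using uscale[OF that, of "- 1"] by simp
    with ge[OF that] ge[of "- x"] that show ?thesis
      by (simp add: S subspace_neg linear_neg[OF m(1)])
  qed
  moreover have "m x \<le> p x" for x
    using m(2) q(2) order_trans by blast
  ultimately show ?thesis using m(1) that by blast
qed

lemma complex_linear_0: "complex_linear f \<Longrightarrow> f 0 = 0"
  unfolding complex_linear_def by (metis add_cancel_left_left)

lemma complex_linear_imp_linear: "complex_linear f \<Longrightarrow> linear f"
  unfolding complex_linear_def by (intro linearI) (auto simp flip: scaleC_of_real)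

lemma complex_linear_imp_bounded_linear:
  assumes "complex_linear f" "\<And>x. norm (f x) \<le> M * norm x"
  shows "bounded_linear f"
  using complex_linear_imp_linear[OF assms(1)] assms(2)
  by (intro bounded_linear_intro[of f M]) (auto simp: linear_iff mult.commute)

lemma cnj_sgn_mult: "cnj (sgn z) * z = complex_of_real (norm z)"
proof (cases "z = 0")
  case False
  have "complex_of_real (norm z) * complex_of_real (norm z) = z * cnj z"
    using complex_norm_square[of z] by (simp add: power2_eq_square)
  with False show ?thesis
    by (simp add: sgn_eq field_simps)
qed simp

text \<open>
  The complex case: extend the real part to \<open>m\<close> and put \<open>h x = m x - \<i> m (\<i> x)\<close>. Rotating \<open>x\<close>
  so that \<open>h x\<close> becomes a nonnegative real transfers the bound from \<open>m\<close> to \<open>h\<close>.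
\<close>

lemma hahn_banach:
  fixes S :: "'a::complex_normed_vector set" and g :: "'a \<Rightarrow> complex"
  assumes S0: "0 \<in> S" and Sadd: "\<And>x y. x \<in> S \<Longrightarrow> y \<in> S \<Longrightarrow> x + y \<in> S"
    and Sscale: "\<And>c x. x \<in> S \<Longrightarrow> c *\<^sub>C x \<in> S"
    and gadd: "\<And>x y. x \<in> S \<Longrightarrow> y \<in> S \<Longrightarrow> g (x + y) = g x + g y"
    and gscale: "\<And>c x. x \<in> S \<Longrightarrow> g (c *\<^sub>C x) = c * g x"
    and le: "\<And>x. x \<in> S \<Longrightarrow> norm (g x) \<le> M * norm x" and M: "0 \<le> M"
  obtains h where "complex_linear h" "\<And>x. x \<in> S \<Longrightarrow> h x = g x" "\<And>x. norm (h x) \<le> M * norm x"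
proof -
  have "sublinear (\<lambda>x::'a. M * norm x)"
    using M by (intro sublinearI) (auto simp: norm_triangle_ineq mult_left_mono simp flip: distrib_left)
  moreover have "subspace S"
    by (auto simp: subspace_def S0 Sadd Sscale simp flip: scaleC_of_real)
  moreover have "Re (g x) \<le> M * norm x" if "x \<in> S" for x
    using le[OF that] complex_Re_le_cmod[of "g x"] by linarith
  ultimately obtain m where m: "linear m" "\<And>x. m x \<le> M * norm x" "\<And>x. x \<in> S \<Longrightarrow> m x = Re (g x)"
    using hahn_banach_real[of "\<lambda>x. M * norm x" S "\<lambda>x. Re (g x)"]
    by (auto simp: gadd gscale simp flip: scaleC_of_real)
  define h where "h x = Complex (m x) (- m (\<i> *\<^sub>C x))" for x
  have m_add: "m (x + y) = m x + m y" and m_scale: "m (r *\<^sub>R x) = r * m x" for x y r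
    using m(1) by (auto simp: linear_iff)
  have lin: "complex_linear h"
    unfolding complex_linear_def
  proof (intro conjI allI)
    show "h (x + y) = h x + h y" for x y
      by (simp add: h_def complex_eq_iff scaleC_add_right m_add)
    fix c :: complex and x :: 'a
    have ii: "\<i> *\<^sub>C \<i> *\<^sub>C x = (- 1) *\<^sub>R x"
      using scaleC_of_real[of "- 1" x] by (simp add: scaleC_scaleC)
    have "c = complex_of_real (Re c) + complex_of_real (Im c) * \<i>"
      by (simp add: complex_eq_iff)
    then have c: "c *\<^sub>C y = Re c *\<^sub>R y + Im c *\<^sub>R \<i> *\<^sub>C y" for y :: 'a
      by (metis scaleC_add_left scaleC_of_real scaleC_scaleC)
    have m_ic: "m (\<i> *\<^sub>C c *\<^sub>C x) = Re c * m (\<i> *\<^sub>C x) - Im c * m x"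
    proof -
      have "\<i> *\<^sub>C c *\<^sub>C x = c *\<^sub>C \<i> *\<^sub>C x"
        by (simp add: scaleC_scaleC mult.commute)
      then show ?thesis
        using linear_diff[OF m(1)] by (simp add: c ii m_scale)
    qed
    show "h (c *\<^sub>C x) = c *\<^sub>C h x"
      by (simp add: h_def scaleC_complex_def complex_eq_iff m_ic)
        (simp add: c m_add m_scale)
  qed
  have "h x = g x" if "x \<in> S" for x
    using m(3)[OF that] m(3)[OF Sscale[OF that, of \<i>]] gscale[OF that, of \<i>]
    by (simp add: h_def complex_eq_iff)
  moreover have "norm (h x) \<le> M * norm x" for x
  proof -
    define c where "c = cnj (sgn (h x))"
    have "norm c \<le> 1"
      by (simp add: c_def norm_sgn)
    have "complex_of_real (norm (h x)) = c * h x"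
      by (simp add: c_def cnj_sgn_mult)
    also have "\<dots> = h (c *\<^sub>C x)"
      using lin by (simp add: complex_linear_def scaleC_complex_def)
    finally have "norm (h x) = Re (h (c *\<^sub>C x))"
      by (metis Re_complex_of_real)
    also have "\<dots> \<le> M * (norm c * norm x)"
      using m(2)[of "c *\<^sub>C x"] by (simp add: h_def norm_scaleC)
    also have "\<dots> \<le> M * norm x"
      using M \<open>norm c \<le> 1\<close> by (intro mult_left_mono mult_left_le_one_le) auto
    finally show ?thesis .
  qed
  ultimately show ?thesis using lin that by blast
qed

lemma norming_functional:
  fixes v :: "'a::complex_normed_vector"
  assumes v: "norm v = 1"
  obtains h :: "'a \<Rightarrow> complex" where "complex_linear h" "h v = 1" "\<And>x. norm (h x) \<le> norm x"
proof -
  have inj: "c *\<^sub>C v = d *\<^sub>C v \<longleftrightarrow> c = d" for c d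
  proof
    assume "c *\<^sub>C v = d *\<^sub>C v"
    then have "(c - d) *\<^sub>C v = 0"
      using scaleC_add_left[of "c - d" d v] by simp
    then have "norm (c - d) * norm v = 0"
      by (metis norm_scaleC norm_zero)
    with v show "c = d" by simp
  qed simp
  define g where "g x = (THE c. x = c *\<^sub>C v)" for x
  have g: "g (c *\<^sub>C v) = c" for c
    by (simp add: g_def inj)
  have v1: "1 *\<^sub>C v = v" and v0: "0 *\<^sub>C v = 0"
    using scaleC_of_real[of 1 v] scaleC_of_real[of 0 v] by simp_all
  obtain h where "complex_linear h" and h: "\<And>x. x \<in> range (\<lambda>c. c *\<^sub>C v) \<Longrightarrow> h x = g x"
    and "\<And>x. norm (h x) \<le> 1 * norm x"
  proof (rule hahn_banach[of "range (\<lambda>c. c *\<^sub>C v)" g 1])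
    show "0 \<in> range (\<lambda>c. c *\<^sub>C v)"
      by (metis rangeI v0)
  qed (auto simp: g scaleC_scaleC v norm_scaleC simp flip: scaleC_add_left)
  moreover have "h v = 1"
    using h[of v] g[of 1] v1 by (metis rangeI)
  ultimately show ?thesis by (intro that[of h]) auto
qed

section \<open>Increments of bounded holomorphic functions\<close>

text \<open>
  Every point of the closed unit disc is the centre of a disc of radius \<open>R / 2\<close> inside the disc
  of radius \<open>R\<close>, so Cauchy's inequalities bound the first and second derivatives there by
  \<open>2 M / R\<close> and \<open>8 M / R\<^sup>2\<close>.
\<close>

lemma Taylor_estimates_of_bounded:
  fixes G :: "complex \<Rightarrow> complex"
  assumes hol: "G holomorphic_on ball 0 R" and R: "2 < R"
    and bound: "\<And>z. z \<in> ball 0 R \<Longrightarrow> norm (G z) \<le> M"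
  shows "norm (G 1 - G 0) \<le> 2 * M / R"
    and "norm (G 1 - G 0 - deriv G 0) \<le> 8 * M / R\<^sup>2"
proof -
  have sub: "cball x (R / 2) \<subseteq> ball 0 R" if "x \<in> cball 0 1" for x :: complex
  proof
    fix y assume "y \<in> cball x (R / 2)"
    then have "norm (y - x) \<le> R / 2"
      by (simp add: dist_norm norm_minus_commute)
    then show "y \<in> ball 0 R"
      using that R norm_triangle_ineq[of x "y - x"] by simp
  qed
  have higher: "norm ((deriv ^^ n) G x) \<le> fact n * M / (R / 2) ^ n" if "x \<in> cball 0 1" for n x
  proof (rule Cauchy_inequality)
    show "G holomorphic_on ball x (R / 2)"
      using hol sub[OF that] ball_subset_cball holomorphic_on_subset by blast
    show "continuous_on (cball x (R / 2)) G"
      using hol sub[OF that] holomorphic_on_imp_continuous_on holomorphic_on_subset by blast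
    show "norm (G y) \<le> M" if "norm (x - y) = R / 2" for y
      using bound[of y] sub[OF \<open>x \<in> cball 0 1\<close>] that by (auto simp: dist_norm subset_iff)
  qed (use R in simp)
  have deriv: "((deriv ^^ i) G has_field_derivative (deriv ^^ Suc i) G x) (at x within cball 0 1)"
    if "x \<in> cball 0 1" for i x
  proof -
    have "(deriv ^^ i) G holomorphic_on ball 0 R"
      by (rule holomorphic_higher_deriv[OF hol]) simp
    then have "((deriv ^^ i) G has_field_derivative deriv ((deriv ^^ i) G) x) (at x)"
      by (rule holomorphic_derivI) (use that R in auto)
    then show ?thesis
      by (auto intro: has_field_derivative_at_within)
  qed
  have "norm ((deriv ^^ 0) G 1 - (\<Sum>i\<le>0. (deriv ^^ i) G 0 * (1 - 0) ^ i / fact i))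
      \<le> (fact (Suc 0) * M / (R / 2) ^ Suc 0) * norm (1 - 0 :: complex) ^ Suc 0 / fact 0"
  proof (rule complex_Taylor[where S = "cball 0 1" and f = "\<lambda>i. (deriv ^^ i) G"])
    show "norm ((deriv ^^ Suc 0) G x) \<le> fact (Suc 0) * M / (R / 2) ^ Suc 0" if "x \<in> cball 0 1" for x
      by (rule higher[OF that])
    show "((deriv ^^ i) G has_field_derivative (deriv ^^ Suc i) G x) (at x within cball 0 1)"
      if "x \<in> cball 0 1" for i x
      by (rule deriv[OF that])
  qed auto
  then show "norm (G 1 - G 0) \<le> 2 * M / R"
    by (simp add: field_simps)
  have "norm ((deriv ^^ 0) G 1 - (\<Sum>i\<le>1. (deriv ^^ i) G 0 * (1 - 0) ^ i / fact i))
      \<le> (fact (Suc 1) * M / (R / 2) ^ Suc 1) * norm (1 - 0 :: complex) ^ Suc 1 / fact 1"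
  proof (rule complex_Taylor[where S = "cball 0 1" and f = "\<lambda>i. (deriv ^^ i) G"])
    show "norm ((deriv ^^ Suc 1) G x) \<le> fact (Suc 1) * M / (R / 2) ^ Suc 1" if "x \<in> cball 0 1" for x
      by (rule higher[OF that])
    show "((deriv ^^ i) G has_field_derivative (deriv ^^ Suc i) G x) (at x within cball 0 1)"
      if "x \<in> cball 0 1" for i x
      by (rule deriv[OF that])
  qed auto
  then show "norm (G 1 - G 0 - deriv G 0) \<le> 8 * M / R\<^sup>2"
    by (simp add: field_simps power2_eq_square)
qed

lemma bounded_linear_scaleC_left: "bounded_linear (\<lambda>z. z *\<^sub>C (v :: 'a::complex_normed_vector))"
  by (intro bounded_linear_intro[of _ "norm v"])
    (simp_all add: scaleC_add_left norm_scaleC scaleR_conv_of_real scaleC_of_real flip: scaleC_scaleC)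

lemma has_field_derivative_along_line:
  fixes F :: "'a::complex_normed_vector \<Rightarrow> complex"
  assumes lin: "complex_linear F'" and der: "(F has_derivative F') (at (x + z *\<^sub>C v))"
  shows "((\<lambda>w. F (x + w *\<^sub>C v)) has_field_derivative F' v) (at z)"
proof -
  have "((\<lambda>w. x + w *\<^sub>C v) has_derivative (\<lambda>w. w *\<^sub>C v)) (at z)"
    using has_derivative_add[OF has_derivative_const bounded_linear_imp_has_derivative[OF bounded_linear_scaleC_left]]
    by fastforce
  from has_derivative_compose[OF this der]
  have "((\<lambda>w. F (x + w *\<^sub>C v)) has_derivative (\<lambda>w. F' (w *\<^sub>C v))) (at z)" .
  moreover have "(\<lambda>w. F' (w *\<^sub>C v)) = (*) (F' v)"
    using lin by (auto simp: complex_linear_def scaleC_complex_def)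
  ultimately show ?thesis
    by (simp add: has_field_derivative_def)
qed

definition hinf_deriv :: "'e::complex_normed_vector hinf \<Rightarrow> 'e \<Rightarrow> 'e \<Rightarrow> complex"
  where "hinf_deriv g x = frechet_derivative (apply_hinf g) (at x)"

lemma hinf_has_derivative:
  assumes "x \<in> ball 0 1"
  shows "complex_linear (hinf_deriv g x)" "(apply_hinf g has_derivative hinf_deriv g x) (at x)"
proof -
  from assms apply_hinf[of g] obtain g' where "complex_linear g'" "(apply_hinf g has_derivative g') (at x)"
    unfolding holomorphic_on_unit_ball_def by blast
  then show "complex_linear (hinf_deriv g x)" "(apply_hinf g has_derivative hinf_deriv g x) (at x)"
    using frechet_derivative_at by (auto simp: hinf_deriv_def)
qed

lemma hinf_deriv_unique:
  assumes "x \<in> ball 0 1" "(apply_hinf g has_derivative g') (at x)"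
  shows "hinf_deriv g x = g'"
  using hinf_has_derivative(2)[OF assms(1)] assms(2) by (rule has_derivative_unique)

lemma hinf_deriv_add:
  assumes "x \<in> ball 0 1"
  shows "hinf_deriv (f + g) x h = hinf_deriv f x h + hinf_deriv g x h"
proof -
  have "(apply_hinf (f + g) has_derivative (\<lambda>h. hinf_deriv f x h + hinf_deriv g x h)) (at x)"
    unfolding plus_hinf.rep_eq by (intro has_derivative_add hinf_has_derivative assms)
  from hinf_deriv_unique[OF assms this] show ?thesis by simp
qed

lemma hinf_deriv_scaleC:
  assumes "x \<in> ball 0 1"
  shows "hinf_deriv (c *\<^sub>C g) x h = c * hinf_deriv g x h"
proof -
  have "(apply_hinf (c *\<^sub>C g) has_derivative (\<lambda>h. c * hinf_deriv g x h)) (at x)"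
    unfolding scaleC_hinf.rep_eq by (intro has_derivative_mult_right hinf_has_derivative assms)
  from hinf_deriv_unique[OF assms this] show ?thesis by simp
qed

text \<open>
  These bounds depend on \<open>g\<close> only through its norm. The first makes the unit ball of
  \<open>H\<^sup>\<infinity>\<close> equicontinuous, and the second makes \<open>x \<mapsto> \<delta>\<^sub>x\<close> differentiable in the norm of the
  predual. Both are the one-variable estimates for \<open>z \<mapsto> g (x + z h)\<close>, which is defined for
  \<open>\<bar>z\<bar> < (1 - \<parallel>x\<parallel>) / \<parallel>h\<parallel>\<close>.
\<close>

lemma hinf_increment_estimates:
  fixes g :: "'e::complex_normed_vector hinf"
  assumes h: "2 * norm h < 1 - norm x"
  shows "norm (apply_hinf g (x + h) - apply_hinf g x) \<le> 2 * norm g * norm h / (1 - norm x)"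
    and "norm (apply_hinf g (x + h) - apply_hinf g x - hinf_deriv g x h)
      \<le> 8 * norm g * (norm h)\<^sup>2 / (1 - norm x)\<^sup>2"
proof -
  have x1: "norm x < 1"
    using h norm_ge_zero[of h] by linarith
  then have x: "x \<in> ball 0 1" by simp
  have "norm (apply_hinf g (x + h) - apply_hinf g x) \<le> 2 * norm g * norm h / (1 - norm x) \<and>
    norm (apply_hinf g (x + h) - apply_hinf g x - hinf_deriv g x h)
      \<le> 8 * norm g * (norm h)\<^sup>2 / (1 - norm x)\<^sup>2"
  proof (cases "h = 0")
    case True
    then show ?thesis
      using complex_linear_0[OF hinf_has_derivative(1)[OF x]] by simp
  next
    case False
    define R where "R = (1 - norm x) / norm h"
    define G where "G z = apply_hinf g (x + z *\<^sub>C h)" for z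
    have R: "2 < R"
      using False h by (simp add: R_def field_simps)
    have "x + z *\<^sub>C h \<in> ball 0 1" if "z \<in> ball 0 R" for z
    proof -
      have "norm (z *\<^sub>C h) < 1 - norm x"
        using that False by (simp add: R_def norm_scaleC field_simps)
      then show ?thesis
        using norm_triangle_ineq[of x "z *\<^sub>C h"] by simp
    qed
    then have der: "(G has_field_derivative hinf_deriv g (x + z *\<^sub>C h) h) (at z)" if "z \<in> ball 0 R" for z
      unfolding G_def using that by (intro has_field_derivative_along_line hinf_has_derivative)
    have h0: "0 *\<^sub>C h = 0" and h1: "1 *\<^sub>C h = h"
      using scaleC_of_real[of 0 h] scaleC_of_real[of 1 h] by simp_all
    have "G holomorphic_on ball 0 R"
      using der unfolding holomorphic_on_open[OF open_ball] by blast
    moreover have "norm (G z) \<le> norm g" for z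
      by (simp add: G_def norm_apply_hinf_le)
    moreover have "deriv G 0 = hinf_deriv g x h"
      using DERIV_imp_deriv[OF der[of 0]] R by (simp add: h0)
    ultimately have "norm (G 1 - G 0) \<le> 2 * norm g / R"
      "norm (G 1 - G 0 - hinf_deriv g x h) \<le> 8 * norm g / R\<^sup>2"
      using Taylor_estimates_of_bounded[of G R "norm g"] R by simp_all
    then show ?thesis
      using False by (simp add: G_def h0 h1 R_def power_divide)
  qed
  then show "norm (apply_hinf g (x + h) - apply_hinf g x) \<le> 2 * norm g * norm h / (1 - norm x)"
    and "norm (apply_hinf g (x + h) - apply_hinf g x - hinf_deriv g x h)
      \<le> 8 * norm g * (norm h)\<^sup>2 / (1 - norm x)\<^sup>2"
    by blast+
qed

text \<open>
  At the rescaled increment \<open>t h\<close> of length \<open>(1 - \<parallel>x\<parallel>) / 4\<close> both the increment of \<open>g\<close> and its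
  distance from the derivative are at most \<open>\<parallel>g\<parallel> / 2\<close>.
\<close>

lemma norm_hinf_deriv_le:
  fixes g :: "'e::complex_normed_vector hinf"
  assumes x: "x \<in> ball 0 1"
  shows "norm (hinf_deriv g x h) \<le> 4 * norm h / (1 - norm x) * norm g"
proof (cases "h = 0")
  case True
  then show ?thesis
    using complex_linear_0[OF hinf_has_derivative(1)[OF x]] by simp
next
  case False
  have r: "0 < 1 - norm x"
    using x by simp
  define t where "t = (1 - norm x) / (4 * norm h)"
  have t: "0 < t"
    using r False by (simp add: t_def)
  have th: "norm (t *\<^sub>R h) = (1 - norm x) / 4"
    using r False by (simp add: t_def)
  then have small: "2 * norm (t *\<^sub>R h) < 1 - norm x"
    using r by simp
  have cancel: "2 * a * (d / 4) / d = a / 2" "8 * a * (d / 4)\<^sup>2 / d\<^sup>2 = a / 2" if "0 < d" for a d :: real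
    using that by (simp_all add: power2_eq_square)
  have "norm (apply_hinf g (x + t *\<^sub>R h) - apply_hinf g x) \<le> norm g / 2"
    using hinf_increment_estimates(1)[OF small, of g] by (simp only: th cancel[OF r])
  moreover have "norm (apply_hinf g (x + t *\<^sub>R h) - apply_hinf g x - hinf_deriv g x (t *\<^sub>R h)) \<le> norm g / 2"
    using hinf_increment_estimates(2)[OF small, of g] by (simp only: th cancel[OF r])
  ultimately have "norm (hinf_deriv g x (t *\<^sub>R h)) \<le> norm g"
    using norm_triangle_ineq4[of "apply_hinf g (x + t *\<^sub>R h) - apply_hinf g x"
        "apply_hinf g (x + t *\<^sub>R h) - apply_hinf g x - hinf_deriv g x (t *\<^sub>R h)"]
    by simp
  moreover have "hinf_deriv g x (t *\<^sub>R h) = t *\<^sub>R hinf_deriv g x h"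
    using complex_linear_imp_linear[OF hinf_has_derivative(1)[OF x]] by (rule linear_scale)
  ultimately have "t * norm (hinf_deriv g x h) \<le> norm g"
    using t by simp
  then show ?thesis
    using t r False by (simp add: t_def field_simps)
qed

lemma hinf_of_holomorphic:
  fixes F :: "'e::complex_normed_vector \<Rightarrow> complex"
  assumes F: "holomorphic_on_unit_ball F" and bound: "\<And>x. x \<in> ball 0 1 \<Longrightarrow> norm (F x) \<le> B"
  obtains g :: "'e hinf" where "\<And>x. x \<in> ball 0 1 \<Longrightarrow> apply_hinf g x = F x" "norm g \<le> B"
proof
  let ?G = "\<lambda>x. if x \<in> ball 0 1 then F x else 0"
  have "holomorphic_on_unit_ball ?G"
    unfolding holomorphic_on_unit_ball_def
  proof
    fix x :: 'e assume x: "x \<in> ball 0 1"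
    with F obtain F' where "complex_linear F'" "(F has_derivative F') (at x)"
      unfolding holomorphic_on_unit_ball_def by blast
    moreover from this(2) have "(?G has_derivative F') (at x)"
      by (rule has_derivative_transform_within_open[OF _ open_ball x]) simp
    ultimately show "\<exists>G'. complex_linear G' \<and> (?G has_derivative G') (at x)"
      by blast
  qed
  moreover have "bounded (?G ` ball 0 1)"
    using bound by (auto simp: bounded_iff intro!: exI[of _ B])
  ultimately have inv: "apply_hinf (Abs_hinf ?G) = ?G"
    by (intro Abs_hinf_inverse) auto
  then show "apply_hinf (Abs_hinf ?G) x = F x" if "x \<in> ball 0 1" for x
    using that by simp
  show "norm (Abs_hinf ?G) \<le> B"
    by (rule norm_hinf_le) (use inv bound in auto)
qed

section \<open>Point evaluations and derivatives in the predual\<close>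

lemma functional_of_ginf_scaleC: "functional_of_ginf (c *\<^sub>C \<phi>) f = c * functional_of_ginf \<phi> f"
  by (simp add: scaleC_ginf.rep_eq cmult_blinfun.rep_eq)

lemma functional_of_ginf_add: "functional_of_ginf (\<phi> + \<psi>) f = functional_of_ginf \<phi> f + functional_of_ginf \<psi> f"
  by (simp add: plus_ginf.rep_eq plus_blinfun.rep_eq)

lemma functional_of_ginf_scaleR: "functional_of_ginf (r *\<^sub>R \<phi>) f = r *\<^sub>R functional_of_ginf \<phi> f"
  by (simp add: functional_of_ginf_scaleC scaleR_conv_of_real flip: scaleC_of_real)

lemma functional_of_ginf_diff: "functional_of_ginf (\<phi> - \<psi>) f = functional_of_ginf \<phi> f - functional_of_ginf \<psi> f"
  using functional_of_ginf_add[of "\<phi> - \<psi>" \<psi> f] by simp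

lemma functional_of_ginf_sum: "functional_of_ginf (\<Sum>i\<in>I. \<phi> i) f = (\<Sum>i\<in>I. functional_of_ginf (\<phi> i) f)"
  by (induction I rule: infinite_finite_induct)
    (simp_all add: functional_of_ginf_add zero_ginf.rep_eq)

lemma complex_linear_functional_of_ginf: "complex_linear (blinfun_apply (functional_of_ginf \<phi>))"
  using functional_of_ginf[of \<phi>] by simp

lemma ginf_eqI: "(\<And>f. functional_of_ginf \<phi> f = functional_of_ginf \<psi> f) \<Longrightarrow> \<phi> = \<psi>"
  by (metis blinfun_eqI functional_of_ginf_inject)

lemma norm_functional_of_ginf_le: "norm (functional_of_ginf \<phi> f) \<le> norm \<phi> * norm f"
  by (simp add: norm_ginf.rep_eq norm_blinfun)

lemma norm_ginf_le:
  assumes "0 \<le> B" "\<And>f. norm (functional_of_ginf \<phi> f) \<le> B * norm f"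
  shows "norm \<phi> \<le> B"
  unfolding norm_ginf.rep_eq using assms by (rule norm_blinfun_bound)

text \<open>
  The predual is complete and embeds isometrically, so its image is closed in the dual of
  \<open>H\<^sup>\<infinity>\<close>: norm limits of functionals that are continuous for the compact-open topology stay in it.
\<close>

lemma closed_range_functional_of_ginf:
  fixes X :: "nat \<Rightarrow> 'e::complex_normed_vector ginf"
  assumes "(\<lambda>n. functional_of_ginf (X n)) \<longlonglongrightarrow> L"
  obtains \<phi> where "functional_of_ginf \<phi> = L"
proof -
  have "Cauchy (\<lambda>n. functional_of_ginf (X n))"
    using assms LIMSEQ_imp_Cauchy by blast
  then have "Cauchy X"
    by (simp add: Cauchy_def dist_functional_of_ginf)
  then obtain \<phi> where "X \<longlonglongrightarrow> \<phi>"
    using Cauchy_convergent_iff convergent_def by blast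
  then have "(\<lambda>n. functional_of_ginf (X n)) \<longlonglongrightarrow> functional_of_ginf \<phi>"
    by (simp add: tendsto_iff dist_functional_of_ginf)
  with assms have "functional_of_ginf \<phi> = L"
    using LIMSEQ_unique by blast
  then show ?thesis by (rule that)
qed

lift_definition hinf_evaluation :: "'e::complex_normed_vector \<Rightarrow> 'e hinf \<Rightarrow>\<^sub>L complex"
  is "\<lambda>x f. apply_hinf f x"
proof -
  fix x :: 'e
  show "bounded_linear (\<lambda>f. apply_hinf f x)"
    by (intro bounded_linear_intro[of _ 1])
      (simp_all add: plus_hinf.rep_eq scaleR_hinf_def scaleC_hinf.rep_eq scaleR_conv_of_real
        norm_apply_hinf_le)
qed

lemma topspace_compact_open_topology:
  "topspace (compact_open_topology :: 'e::complex_normed_vector hinf topology) = UNIV"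
proof -
  have "openin (compact_open_topology :: 'e hinf topology) {f. apply_hinf f ` {} \<subseteq> UNIV}"
    unfolding compact_open_topology_def
    by (rule topology_generated_by_Basis) (use compact_empty open_UNIV in blast)
  then show ?thesis
    using openin_subset by fastforce
qed

text \<open>
  The point mass \<open>\<delta>\<^sub>x\<close>. It is defined on the whole space; outside the ball it is zero, since
  functions in \<open>H\<^sup>\<infinity>\<close> are extended by zero.
\<close>

lift_definition point_eval :: "'e::complex_normed_vector \<Rightarrow> 'e ginf"
  is hinf_evaluation
proof -
  fix x :: 'e
  have "continuous_map (compact_open_topology :: 'e hinf topology) euclidean (\<lambda>f. apply_hinf f x)"
  proof (cases "x \<in> ball 0 1")
    case True
    have "openin (compact_open_topology :: 'e hinf topology) {f. apply_hinf f x \<in> U}" if "open U" for U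
    proof -
      have "{f. apply_hinf f x \<in> U} = {f. apply_hinf f ` {x} \<subseteq> U}"
        by simp
      also have "openin (compact_open_topology :: 'e hinf topology) \<dots>"
        unfolding compact_open_topology_def
      proof (rule topology_generated_by_Basis, intro CollectI exI conjI)
        show "compact {x}" "{x} \<subseteq> ball 0 1" "open U"
          using True that by auto
      qed (rule refl)
      finally show ?thesis .
    qed
    then show ?thesis
      by (simp add: continuous_map_def topspace_compact_open_topology)
  next
    case False
    then have "(\<lambda>f :: 'e hinf. apply_hinf f x) = (\<lambda>f. 0)"
      using apply_hinf by auto
    then show ?thesis by simp
  qed
  then show "complex_linear (blinfun_apply (hinf_evaluation x)) \<and>
    continuous_map (subtopology compact_open_topology (cball 0 1)) euclidean (blinfun_apply (hinf_evaluation x))"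
    by (simp add: hinf_evaluation.rep_eq complex_linear_def plus_hinf.rep_eq scaleC_hinf.rep_eq
        scaleC_complex_def continuous_map_from_subtopology)
qed

lemma functional_of_point_eval [simp]: "functional_of_ginf (point_eval x) f = apply_hinf f x"
  by (simp add: point_eval.rep_eq hinf_evaluation.rep_eq)

lemma norm_point_eval_le: "norm (point_eval x) \<le> 1"
  by (rule norm_ginf_le) (simp_all add: norm_apply_hinf_le)

text \<open>
  The functional \<open>g \<mapsto> g'(x) h\<close> is the norm limit of the difference quotients
  \<open>n (\<delta>\<^bsub>x + h/n\<^esub> - \<delta>\<^sub>x)\<close>: by the second-order estimate the error is of order \<open>1 / n\<close>
  uniformly on the unit ball of \<open>H\<^sup>\<infinity>\<close>.
\<close>

lemma derivative_functional_in_ginf: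
  fixes x h :: "'e::complex_normed_vector"
  assumes x: "x \<in> ball 0 1"
  obtains \<phi> :: "'e ginf" where "\<And>g. functional_of_ginf \<phi> g = hinf_deriv g x h"
proof -
  have bl: "bounded_linear (\<lambda>g. hinf_deriv g x h)"
  proof (rule complex_linear_imp_bounded_linear)
    show "complex_linear (\<lambda>g. hinf_deriv g x h)"
      by (simp add: complex_linear_def scaleC_complex_def hinf_deriv_add[OF x] hinf_deriv_scaleC[OF x])
    show "norm (hinf_deriv g x h) \<le> 4 * norm h / (1 - norm x) * norm g" for g
      by (rule norm_hinf_deriv_le[OF x])
  qed
  have L: "Blinfun (\<lambda>g. hinf_deriv g x h) g = hinf_deriv g x h" for g
    using bl by (simp add: bounded_linear_Blinfun_apply)
  have r: "0 < 1 - norm x" using x by simp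
  define X where "X n = real n *\<^sub>R (point_eval (x + inverse (real n) *\<^sub>R h) - point_eval x)" for n
  define K where "K = 8 * (norm h)\<^sup>2 / (1 - norm x)\<^sup>2"
  have "(\<lambda>n. functional_of_ginf (X n)) \<longlonglongrightarrow> Blinfun (\<lambda>g. hinf_deriv g x h)"
  proof (rule LIM_zero_cancel, rule Lim_null_comparison)
    show "(\<lambda>n. inverse (real n) * K) \<longlonglongrightarrow> 0"
      by (rule tendsto_mult_left_zero[OF lim_inverse_n])
    have "(\<lambda>n. 2 * norm (inverse (real n) *\<^sub>R h)) \<longlonglongrightarrow> 2 * norm (0 *\<^sub>R h)"
      by (intro tendsto_intros lim_inverse_n)
    then have "\<forall>\<^sub>F n in sequentially. 2 * norm (inverse (real n) *\<^sub>R h) < 1 - norm x"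
      by (rule order_tendstoD(2)) (use r in simp)
    then show "\<forall>\<^sub>F n in sequentially.
        norm (functional_of_ginf (X n) - Blinfun (\<lambda>g. hinf_deriv g x h)) \<le> inverse (real n) * K"
      using eventually_gt_at_top[of 0]
    proof eventually_elim
      case (elim n)
      show ?case
      proof (rule norm_blinfun_bound)
        show "0 \<le> inverse (real n) * K" by (simp add: K_def)
        fix g
        let ?d = "apply_hinf g (x + inverse (real n) *\<^sub>R h) - apply_hinf g x"
        have "hinf_deriv g x (inverse (real n) *\<^sub>R h) = inverse (real n) *\<^sub>R hinf_deriv g x h"
          using complex_linear_imp_linear[OF hinf_has_derivative(1)[OF x]] by (rule linear_scale)
        then have "(functional_of_ginf (X n) - Blinfun (\<lambda>g. hinf_deriv g x h)) g
            = real n *\<^sub>R (?d - hinf_deriv g x (inverse (real n) *\<^sub>R h))"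
          using elim(2)
          by (simp add: X_def L blinfun.bilinear_simps functional_of_ginf_scaleR functional_of_ginf_diff
              scaleR_diff_right)
        then have "norm ((functional_of_ginf (X n) - Blinfun (\<lambda>g. hinf_deriv g x h)) g)
            = real n * norm (?d - hinf_deriv g x (inverse (real n) *\<^sub>R h))"
          by simp
        also have "\<dots> \<le> real n * (8 * norm g * (norm (inverse (real n) *\<^sub>R h))\<^sup>2 / (1 - norm x)\<^sup>2)"
          by (intro mult_left_mono hinf_increment_estimates(2) elim) simp
        also have "\<dots> = inverse (real n) * K * norm g"
          using elim(2) by (simp add: K_def power2_eq_square)
        finally show "norm ((functional_of_ginf (X n) - Blinfun (\<lambda>g. hinf_deriv g x h)) g)
          \<le> inverse (real n) * K * norm g" .
      qed
    qed
  qed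
  then obtain \<phi> where "functional_of_ginf \<phi> = Blinfun (\<lambda>g. hinf_deriv g x h)"
    by (rule closed_range_functional_of_ginf)
  then show ?thesis
    using L that by metis
qed

lemma has_derivative_of_quadratic_remainder:
  fixes f :: "'a::real_normed_vector \<Rightarrow> 'b::real_normed_vector"
  assumes bl: "bounded_linear f'" and d: "0 < d" and K: "0 \<le> K"
    and rem: "\<And>h. norm h < d \<Longrightarrow> norm (f (x + h) - f x - f' h) \<le> K * (norm h)\<^sup>2"
  shows "(f has_derivative f') (at x)"
  unfolding has_derivative_at_alt
proof (intro conjI allI impI bl)
  fix e :: real assume e: "0 < e"
  show "\<exists>d>0. \<forall>y. norm (y - x) < d \<longrightarrow> norm (f y - f x - f' (y - x)) \<le> e * norm (y - x)"
  proof (intro exI conjI allI impI)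
    show "0 < min d (e / (K + 1))"
      using d K e by simp
    fix y assume y: "norm (y - x) < min d (e / (K + 1))"
    then have "norm (f y - f x - f' (y - x)) \<le> K * norm (y - x) * norm (y - x)"
      using rem[of "y - x"] by (simp add: power2_eq_square)
    also have "\<dots> \<le> e * norm (y - x)"
    proof (rule mult_right_mono)
      have "(K + 1) * norm (y - x) \<le> e"
        using y K by (simp add: field_simps)
      then show "K * norm (y - x) \<le> e"
        using norm_ge_zero[of "y - x"] by (simp only: distrib_right)
    qed simp
    finally show "norm (f y - f x - f' (y - x)) \<le> e * norm (y - x)" .
  qed
qed

text \<open>
  The map \<open>x \<mapsto> \<delta>\<^sub>x\<close> is differentiable in norm, with derivative \<open>D\<close> sending \<open>h\<close> to the
  functional \<open>g \<mapsto> g'(x) h\<close>, and \<open>\<xi>\<close> preserves differentiability.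
\<close>

lemma holomorphic_of_functional_on_ginf:
  fixes \<xi> :: "'e::complex_normed_vector ginf \<Rightarrow>\<^sub>L complex"
  assumes \<xi>: "complex_linear (blinfun_apply \<xi>)"
  shows "holomorphic_on_unit_ball (\<lambda>x. \<xi> (point_eval x))"
  unfolding holomorphic_on_unit_ball_def
proof
  fix x :: 'e assume x: "x \<in> ball 0 1"
  then have r: "0 < 1 - norm x" by simp
  have "\<exists>\<phi> :: 'e ginf. \<forall>g. functional_of_ginf \<phi> g = hinf_deriv g x h" for h
    using derivative_functional_in_ginf[OF x] by metis
  then obtain D :: "'e \<Rightarrow> 'e ginf" where D: "\<And>h g. functional_of_ginf (D h) g = hinf_deriv g x h"
    by metis
  have lin: "hinf_deriv g x (h + k) = hinf_deriv g x h + hinf_deriv g x k"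
    "hinf_deriv g x (c *\<^sub>C h) = c * hinf_deriv g x h" for g h k c
    using hinf_has_derivative(1)[OF x, of g] by (auto simp: complex_linear_def scaleC_complex_def)
  have D_add: "D (h + k) = D h + D k" for h k
    by (rule ginf_eqI) (simp add: D lin functional_of_ginf_add)
  have D_scale: "D (c *\<^sub>C h) = c *\<^sub>C D h" for c h
    by (rule ginf_eqI) (simp add: D lin functional_of_ginf_scaleC)
  let ?f' = "\<lambda>h. \<xi> (D h)"
  have cl: "complex_linear ?f'"
    using \<xi> by (simp add: complex_linear_def D_add D_scale)
  have "norm (D h) \<le> 4 * norm h / (1 - norm x)" for h
    using r by (intro norm_ginf_le) (auto simp only: D norm_hinf_deriv_le[OF x], simp)
  then have "norm (?f' h) \<le> norm \<xi> * (4 * norm h / (1 - norm x))" for h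
    by (meson mult_left_mono norm_blinfun norm_ge_zero order_trans)
  then have "norm (?f' h) \<le> norm \<xi> * 4 / (1 - norm x) * norm h" for h
    by (simp add: mult.assoc)
  with cl have bl: "bounded_linear ?f'"
    by (rule complex_linear_imp_bounded_linear)
  have "((\<lambda>x. \<xi> (point_eval x)) has_derivative ?f') (at x)"
  proof (rule has_derivative_of_quadratic_remainder[OF bl])
    show "0 < (1 - norm x) / 2" using r by simp
    show "0 \<le> norm \<xi> * (8 / (1 - norm x)\<^sup>2)" by simp
    fix h :: 'e assume "norm h < (1 - norm x) / 2"
    then have h: "2 * norm h < 1 - norm x" by simp
    have "norm (point_eval (x + h) - point_eval x - D h) \<le> 8 / (1 - norm x)\<^sup>2 * (norm h)\<^sup>2"
    proof (rule norm_ginf_le)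
      show "norm (functional_of_ginf (point_eval (x + h) - point_eval x - D h) g)
          \<le> 8 / (1 - norm x)\<^sup>2 * (norm h)\<^sup>2 * norm g" for g
        using hinf_increment_estimates(2)[OF h, of g]
        by (simp add: functional_of_ginf_diff D mult_ac)
    qed simp
    then have "norm (\<xi> (point_eval (x + h) - point_eval x - D h)) \<le> norm \<xi> * (8 / (1 - norm x)\<^sup>2 * (norm h)\<^sup>2)"
      by (meson mult_left_mono norm_blinfun norm_ge_zero order_trans)
    then show "norm (\<xi> (point_eval (x + h)) - \<xi> (point_eval x) - \<xi> (D h)) \<le> norm \<xi> * (8 / (1 - norm x)\<^sup>2) * (norm h)\<^sup>2"
      by (simp add: blinfun.bilinear_simps)
  qed
  with cl show "\<exists>f'. complex_linear f' \<and> ((\<lambda>x. \<xi> (point_eval x)) has_derivative f') (at x)"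
    by blast
qed

section \<open>The dual of the predual\<close>

lemma compact_open_neighbourhood_of_0:
  fixes W :: "'e::complex_normed_vector hinf set"
  assumes "openin compact_open_topology W" "0 \<in> W"
  obtains K \<delta> where "compact K" "K \<subseteq> ball 0 1" "0 < \<delta>"
    "\<And>f. (\<And>x. x \<in> K \<Longrightarrow> norm (apply_hinf f x) < \<delta>) \<Longrightarrow> f \<in> W"
proof -
  let ?P = "\<lambda>W. \<exists>K \<delta>. compact K \<and> K \<subseteq> ball 0 1 \<and> 0 < \<delta> \<and>
    (\<forall>f :: 'e hinf. (\<forall>x\<in>K. norm (apply_hinf f x) < \<delta>) \<longrightarrow> f \<in> W)"
  have "generate_topology_on
      {{f :: 'e hinf. apply_hinf f ` K \<subseteq> U} | K U. compact K \<and> K \<subseteq> ball 0 1 \<and> open U} W"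
    using assms(1) by (simp add: compact_open_topology_def openin_topology_generated_by_iff)
  then have "0 \<in> W \<longrightarrow> ?P W"
  proof induction
    case (Int A B)
    show ?case
    proof
      assume "0 \<in> A \<inter> B"
      with Int.IH obtain K \<delta> L \<epsilon> where
        "compact K" "K \<subseteq> ball 0 1" "0 < \<delta>" "\<And>f. (\<forall>x\<in>K. norm (apply_hinf f x) < \<delta>) \<Longrightarrow> f \<in> A"
        "compact L" "L \<subseteq> ball 0 1" "0 < \<epsilon>" "\<And>f. (\<forall>x\<in>L. norm (apply_hinf f x) < \<epsilon>) \<Longrightarrow> f \<in> B"
        by auto
      then show "?P (A \<inter> B)"
        by (intro exI[of _ "K \<union> L"] exI[of _ "min \<delta> \<epsilon>"]) (auto simp: compact_Un)
    qed
  next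
    case (UN \<K>)
    show ?case
    proof
      assume "0 \<in> \<Union>\<K>"
      then obtain A where "A \<in> \<K>" "0 \<in> A" by blast
      with UN.IH obtain K \<delta> where "compact K" "K \<subseteq> ball 0 1" "0 < \<delta>"
        "\<And>f. (\<forall>x\<in>K. norm (apply_hinf f x) < \<delta>) \<Longrightarrow> f \<in> A"
        by meson
      with \<open>A \<in> \<K>\<close> show "?P (\<Union>\<K>)" by blast
    qed
  next
    case (Basis A)
    then obtain K U where A: "A = {f. apply_hinf f ` K \<subseteq> U}" and K: "compact K" "K \<subseteq> ball 0 1"
      and U: "open U"
      by blast
    show ?case
    proof
      assume 0: "0 \<in> A"
      show "?P A"
      proof (cases "K = {}")
        case True
        then show ?thesis
          using K by (intro exI[of _ K] exI[of _ 1]) (simp add: A)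
      next
        case False
        with 0 have "0 \<in> U"
          by (auto simp: A zero_hinf.rep_eq)
        with U obtain \<delta> where "0 < \<delta>" "ball 0 \<delta> \<subseteq> U"
          using open_contains_ball by blast
        then show ?thesis
          using K by (intro exI[of _ K] exI[of _ \<delta>]) (auto simp: A subset_iff)
      qed
    qed
  qed simp
  with assms(2) show ?thesis
    using that by meson
qed

text \<open>
  Continuity at \<open>0\<close> says that \<open>\<phi> f\<close> is small if \<open>f\<close>, in the unit ball, is small on a certain
  compact set \<open>K\<close>. As the unit ball is equicontinuous, it is enough that \<open>f\<close> vanishes on a
  sufficiently fine finite net \<open>F\<close> of \<open>K\<close>; the radius \<open>\<rho> y\<close> of the net shrinks with the distance of
  \<open>y\<close> from the sphere, as the Lipschitz bound does.
\<close>

lemma ginf_almost_determined_by_finitely_many_points: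
  fixes \<phi> :: "'e::complex_normed_vector ginf"
  assumes \<epsilon>: "0 < \<epsilon>"
  obtains F where "finite F" "F \<subseteq> ball 0 1"
    "\<And>f. (\<And>y. y \<in> F \<Longrightarrow> apply_hinf f y = 0) \<Longrightarrow> norm (functional_of_ginf \<phi> f) \<le> \<epsilon> * norm f"
proof -
  let ?T = "subtopology compact_open_topology (cball 0 1) :: 'e hinf topology"
  have "continuous_map ?T euclidean (blinfun_apply (functional_of_ginf \<phi>))"
    using functional_of_ginf[of \<phi>] by simp
  then have "openin ?T {f \<in> topspace ?T. functional_of_ginf \<phi> f \<in> ball 0 \<epsilon>}"
    by (rule openin_continuous_map_preimage) simp
  then obtain W where W: "openin compact_open_topology W"
    and eq: "{f \<in> topspace ?T. functional_of_ginf \<phi> f \<in> ball 0 \<epsilon>} = W \<inter> cball 0 1"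
    by (auto simp: openin_subtopology)
  have sub: "norm (functional_of_ginf \<phi> f) < \<epsilon>" if "f \<in> W" "norm f \<le> 1" for f
  proof -
    have "f \<in> {f \<in> topspace ?T. functional_of_ginf \<phi> f \<in> ball 0 \<epsilon>}"
      unfolding eq using that by simp
    then show ?thesis by simp
  qed
  have "0 \<in> topspace ?T"
    by (simp add: topspace_compact_open_topology)
  then have "0 \<in> W \<inter> cball 0 1"
    unfolding eq[symmetric] using \<epsilon> by (simp add: blinfun.zero_right)
  then have "0 \<in> W" by simp
  then obtain K \<delta> where K: "compact K" "K \<subseteq> ball 0 1" and \<delta>: "0 < \<delta>"
    and small: "\<And>f. (\<And>x. x \<in> K \<Longrightarrow> norm (apply_hinf f x) < \<delta>) \<Longrightarrow> f \<in> W"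
    using compact_open_neighbourhood_of_0[OF W] by blast
  define \<rho> where "\<rho> y = min (1 / 2) (\<delta> / 2) * (1 - norm y)" for y :: 'e
  have \<rho>: "0 < \<rho> y" if "y \<in> K" for y
    using K(2) that \<delta> by (auto simp: \<rho>_def subset_iff)
  obtain F where F: "F \<subseteq> K" "finite F" "K \<subseteq> (\<Union>y\<in>F. ball y (\<rho> y))"
  proof (rule compactE_image[OF K(1), of K "\<lambda>y. ball y (\<rho> y)"])
    show "K \<subseteq> (\<Union>y\<in>K. ball y (\<rho> y))"
      using \<rho> by force
  qed auto
  have bound1: "norm (functional_of_ginf \<phi> f) < \<epsilon>"
    if f: "norm f \<le> 1" and zero: "\<And>y. y \<in> F \<Longrightarrow> apply_hinf f y = 0" for f
  proof (rule sub[OF small f])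
    fix x assume "x \<in> K"
    with F(3) obtain y where y: "y \<in> F" "x \<in> ball y (\<rho> y)" by blast
    define h where "h = x - y"
    have r: "0 < 1 - norm y"
      using F(1) K(2) y(1) by (auto simp: subset_iff)
    have "norm h < \<rho> y"
      using y(2) by (simp add: h_def dist_norm norm_minus_commute)
    moreover have "\<rho> y \<le> 1 / 2 * (1 - norm y)" "\<rho> y \<le> \<delta> / 2 * (1 - norm y)"
      unfolding \<rho>_def using r by (intro mult_right_mono; simp)+
    ultimately have h: "2 * norm h < 1 - norm y" "2 * norm h < \<delta> * (1 - norm y)"
      by simp_all
    have "norm (apply_hinf f x) = norm (apply_hinf f (y + h) - apply_hinf f y)"
      using zero[OF y(1)] by (simp add: h_def)
    also have "\<dots> \<le> 2 * norm f * norm h / (1 - norm y)"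
      by (rule hinf_increment_estimates(1)[OF h(1)])
    also have "\<dots> \<le> 2 * 1 * norm h / (1 - norm y)"
      using r f by (intro divide_right_mono mult_right_mono mult_left_mono) auto
    also have "\<dots> < \<delta>"
      using h(2) r by (simp add: pos_divide_less_eq)
    finally show "norm (apply_hinf f x) < \<delta>" .
  qed
  have "norm (functional_of_ginf \<phi> f) \<le> \<epsilon> * norm f"
    if zero: "\<And>y. y \<in> F \<Longrightarrow> apply_hinf f y = 0" for f
  proof (cases "f = 0")
    case False
    have "norm (functional_of_ginf \<phi> (inverse (norm f) *\<^sub>R f)) < \<epsilon>"
      by (rule bound1) (use False zero in \<open>simp_all add: scaleR_hinf_def scaleC_hinf.rep_eq norm_scaleC norm_inverse\<close>)
    then have "inverse (norm f) * norm (functional_of_ginf \<phi> f) < \<epsilon>"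
      by (simp add: blinfun.scaleR_right)
    then show ?thesis
      using False by (simp add: field_simps)
  qed (simp add: blinfun.zero_right)
  moreover have "F \<subseteq> ball 0 1"
    using F(1) K(2) by (rule order_trans)
  ultimately show ?thesis
    using F(2) that by blast
qed

text \<open>
  Induction on \<open>I\<close>. If some \<open>x0\<close> in the kernels of the other functionals is not in the kernel of
  \<open>l i\<close>, then subtracting the multiple of \<open>l i\<close> that agrees with \<open>\<Lambda>\<close> at \<open>x0\<close> leaves a functional
  vanishing on the kernels of the others; otherwise \<open>l i\<close> is redundant.
\<close>

lemma functional_vanishing_on_finite_intersection_of_kernels:
  fixes l :: "'i \<Rightarrow> 'a::complex_normed_vector \<Rightarrow> complex"
  assumes "finite I" and l: "\<And>i. complex_linear (l i)"
    and "complex_linear \<Lambda>" "\<And>x. (\<And>i. i \<in> I \<Longrightarrow> l i x = 0) \<Longrightarrow> \<Lambda> x = 0"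
  shows "\<exists>c. \<forall>x. \<Lambda> x = (\<Sum>i\<in>I. c i * l i x)"
  using assms(1,3,4)
proof (induction I arbitrary: \<Lambda> rule: finite_induct)
  case empty
  then show ?case by simp
next
  case (insert i I)
  have add: "g (x + y) = g x + g y" and scale: "g (c *\<^sub>C x) = c * g x"
    if "complex_linear g" for g :: "'a \<Rightarrow> complex" and x y c
    using that by (auto simp: complex_linear_def scaleC_complex_def)
  show ?case
  proof (cases "\<exists>x0. (\<forall>j\<in>I. l j x0 = 0) \<and> l i x0 \<noteq> 0")
    case False
    then have "\<exists>c. \<forall>x. \<Lambda> x = (\<Sum>j\<in>I. c j * l j x)"
      using insert.prems by (intro insert.IH) auto
    then obtain c where c: "\<And>x. \<Lambda> x = (\<Sum>j\<in>I. c j * l j x)" by blast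
    have "(\<Sum>j\<in>I. (c(i := 0)) j * l j x) = (\<Sum>j\<in>I. c j * l j x)" for x
      using insert.hyps by (intro sum.cong) auto
    with insert.hyps c show ?thesis
      by (intro exI[of _ "c(i := 0)"]) simp
  next
    case True
    then obtain x0 where x0: "\<And>j. j \<in> I \<Longrightarrow> l j x0 = 0" "l i x0 \<noteq> 0" by blast
    define a where "a = \<Lambda> x0 / l i x0"
    have "\<exists>c. \<forall>x. \<Lambda> x - a * l i x = (\<Sum>j\<in>I. c j * l j x)"
    proof (rule insert.IH)
      show "complex_linear (\<lambda>x. \<Lambda> x - a * l i x)"
        using insert.prems(1) l[of i]
        by (simp add: complex_linear_def scaleC_complex_def algebra_simps)
      fix x assume zero: "\<And>j. j \<in> I \<Longrightarrow> l j x = 0"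
      let ?y = "x + (- l i x / l i x0) *\<^sub>C x0"
      have "\<Lambda> ?y = 0"
        by (rule insert.prems(2)) (use x0 zero in \<open>auto simp: add[OF l] scale[OF l]\<close>)
      then show "\<Lambda> x - a * l i x = 0"
        by (simp add: a_def add[OF insert.prems(1)] scale[OF insert.prems(1)] mult.commute)
    qed
    then obtain c where c: "\<And>x. \<Lambda> x - a * l i x = (\<Sum>j\<in>I. c j * l j x)" by blast
    have "(\<Sum>j\<in>I. (c(i := a)) j * l j x) = (\<Sum>j\<in>I. c j * l j x)" for x
      using insert.hyps by (intro sum.cong) auto
    with insert.hyps show ?thesis
      by (intro exI[of _ "c(i := a)"]) (simp flip: c)
  qed
qed

text \<open>
  Choose \<open>F\<close> such that \<open>\<phi>\<close> has norm at most \<open>\<epsilon>\<close> on the subspace \<open>N\<close> of functions vanishing on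
  \<open>F\<close>, and let \<open>h\<close> be a Hahn--Banach extension of the restriction of \<open>\<phi>\<close> to \<open>N\<close>. Then \<open>\<phi> - h\<close>
  vanishes on \<open>N\<close>, so it is a combination of the evaluations at \<open>F\<close>, and it is within \<open>\<epsilon>\<close> of
  \<open>\<phi>\<close>.
\<close>

lemma span_point_evals_dense:
  fixes \<phi> :: "'e::complex_normed_vector ginf"
  assumes \<epsilon>: "0 < \<epsilon>"
  obtains F c where "finite F" "F \<subseteq> ball 0 1" "norm (\<phi> - (\<Sum>y\<in>F. c y *\<^sub>C point_eval y)) \<le> \<epsilon>"
proof -
  obtain F where F: "finite F" "F \<subseteq> ball 0 1"
    and small: "\<And>f. (\<And>y. y \<in> F \<Longrightarrow> apply_hinf f y = 0) \<Longrightarrow> norm (functional_of_ginf \<phi> f) \<le> \<epsilon> * norm f"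
    using ginf_almost_determined_by_finitely_many_points[OF \<epsilon>] by metis
  let ?N = "{f :: 'e hinf. \<forall>y\<in>F. apply_hinf f y = 0}"
  have lin: "complex_linear (blinfun_apply (functional_of_ginf \<phi>))"
    by (rule complex_linear_functional_of_ginf)
  obtain h where h: "complex_linear h" "\<And>f. f \<in> ?N \<Longrightarrow> h f = functional_of_ginf \<phi> f"
    "\<And>f. norm (h f) \<le> \<epsilon> * norm f"
  proof (rule hahn_banach[of ?N "blinfun_apply (functional_of_ginf \<phi>)" \<epsilon>])
  qed (use lin small \<epsilon> in \<open>auto simp: zero_hinf.rep_eq plus_hinf.rep_eq scaleC_hinf.rep_eq
        complex_linear_def scaleC_complex_def\<close>)
  have "\<exists>c. \<forall>f. functional_of_ginf \<phi> f - h f = (\<Sum>y\<in>F. c y * apply_hinf f y)"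
  proof (rule functional_vanishing_on_finite_intersection_of_kernels[OF F(1)])
    show "complex_linear (\<lambda>f :: 'e hinf. apply_hinf f y)" for y
      by (simp add: complex_linear_def scaleC_complex_def plus_hinf.rep_eq scaleC_hinf.rep_eq)
    show "complex_linear (\<lambda>f. functional_of_ginf \<phi> f - h f)"
      using lin h(1) by (simp add: complex_linear_def scaleC_complex_def algebra_simps)
    show "functional_of_ginf \<phi> f - h f = 0" if "\<And>y. y \<in> F \<Longrightarrow> apply_hinf f y = 0" for f
      using h(2)[of f] that by simp
  qed
  then obtain c where c: "\<And>f. functional_of_ginf \<phi> f - h f = (\<Sum>y\<in>F. c y * apply_hinf f y)" by blast
  have "functional_of_ginf (\<phi> - (\<Sum>y\<in>F. c y *\<^sub>C point_eval y)) f = h f" for f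
    using c[of f] by (simp add: functional_of_ginf_diff functional_of_ginf_sum functional_of_ginf_scaleC
        diff_eq_eq eq_diff_eq add.commute)
  then have "norm (\<phi> - (\<Sum>y\<in>F. c y *\<^sub>C point_eval y)) \<le> \<epsilon>"
    using \<epsilon> h(3) by (intro norm_ginf_le) auto
  with F show ?thesis by (rule that)
qed

text \<open>
  The duality \<open>G\<^sup>\<infinity>(E)\<^sup>* = H\<^sup>\<infinity>(B\<^sub>E)\<close>. The function representing \<open>\<xi>\<close> has to be
  \<open>f x = \<xi> \<delta>\<^sub>x\<close>, which is holomorphic; the two sides of the formula agree on point evaluations,
  hence everywhere by density. In particular \<open>\<parallel>\<xi>\<parallel>\<close> is the supremum of \<open>\<bar>\<xi> \<delta>\<^sub>x\<bar>\<close> over the ball.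
\<close>

lemma dual_of_ginf_is_hinf:
  fixes \<xi> :: "'e::complex_normed_vector ginf \<Rightarrow>\<^sub>L complex"
  assumes \<xi>: "complex_linear (blinfun_apply \<xi>)"
  obtains f :: "'e hinf" where "\<And>\<phi>. \<xi> \<phi> = functional_of_ginf \<phi> f" "norm f = norm \<xi>"
proof -
  have pt: "norm (\<xi> (point_eval x)) \<le> norm \<xi>" for x
    using norm_blinfun[of \<xi> "point_eval x"] norm_point_eval_le[of x]
    by (meson mult_left_le norm_ge_zero order_trans)
  obtain f :: "'e hinf" where f: "\<And>x. x \<in> ball 0 1 \<Longrightarrow> apply_hinf f x = \<xi> (point_eval x)"
    and f_le: "norm f \<le> norm \<xi>"
    by (rule hinf_of_holomorphic[OF holomorphic_of_functional_on_ginf[OF \<xi>] pt]) blast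
  have rep: "\<xi> \<phi> = functional_of_ginf \<phi> f" for \<phi>
  proof -
    have "norm (\<xi> \<phi> - functional_of_ginf \<phi> f) \<le> 0 + e" if e: "0 < e" for e
    proof -
      define \<epsilon> where "\<epsilon> = e / (norm \<xi> + norm f + 1)"
      have pos: "0 < norm \<xi> + norm f + 1"
        by (simp add: add_nonneg_pos)
      then have \<epsilon>: "0 < \<epsilon>"
        using e by (simp add: \<epsilon>_def)
      obtain F c where F: "F \<subseteq> ball 0 1" "norm (\<phi> - (\<Sum>y\<in>F. c y *\<^sub>C point_eval y)) \<le> \<epsilon>"
        by (rule span_point_evals_dense[OF \<epsilon>])
      let ?\<psi> = "\<Sum>y\<in>F. c y *\<^sub>C point_eval y"
      have "\<xi> ?\<psi> = (\<Sum>y\<in>F. c y * \<xi> (point_eval y))"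
        using \<xi> by (simp add: blinfun.sum_right complex_linear_def scaleC_complex_def)
      also have "\<dots> = functional_of_ginf ?\<psi> f"
        unfolding functional_of_ginf_sum functional_of_ginf_scaleC functional_of_point_eval
        using f F(1) by (intro sum.cong) auto
      finally have "\<xi> \<phi> - functional_of_ginf \<phi> f = \<xi> (\<phi> - ?\<psi>) - functional_of_ginf (\<phi> - ?\<psi>) f"
        by (simp add: blinfun.diff_right functional_of_ginf_diff)
      also have "norm \<dots> \<le> norm \<xi> * norm (\<phi> - ?\<psi>) + norm (\<phi> - ?\<psi>) * norm f"
        using norm_triangle_ineq4 norm_blinfun norm_functional_of_ginf_le
        by (meson add_mono order_trans)
      also have "\<dots> = (norm \<xi> + norm f) * norm (\<phi> - ?\<psi>)"
        by (simp add: algebra_simps)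
      also have "\<dots> \<le> (norm \<xi> + norm f + 1) * \<epsilon>"
        using F(2) by (intro mult_mono) auto
      also have "\<dots> = e"
        using pos by (simp add: \<epsilon>_def)
      finally show ?thesis by simp
    qed
    then have "norm (\<xi> \<phi> - functional_of_ginf \<phi> f) \<le> 0"
      by (rule field_le_epsilon)
    then show ?thesis by simp
  qed
  have "norm \<xi> \<le> norm f"
    by (rule norm_blinfun_bound) (simp_all add: rep norm_functional_of_ginf_le mult.commute)
  with f_le rep show ?thesis
    by (intro that) auto
qed

section \<open>Separated points with almost maximal value\<close>

text \<open>
  Schwarz's lemma for \<open>z \<mapsto> (g z - a) / (1 - cnj a (g z))\<close>, where \<open>g = G / N\<close> and \<open>a = g 0\<close>, gives
  \<open>2 \<bar>g(1/2) - a\<bar> \<le> \<bar>1 - cnj a (g(1/2))\<bar> \<le> 1 - \<bar>a\<bar>\<^sup>2 + \<bar>g(1/2) - a\<bar>\<close>.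
\<close>

lemma Schwarz_Pick_half:
  fixes G :: "complex \<Rightarrow> complex"
  assumes hol: "G holomorphic_on ball 0 1" and bound: "\<And>z. norm z < 1 \<Longrightarrow> norm (G z) < N"
    and N: "0 < N"
  shows "N * norm (G (1 / 2) - G 0) \<le> N\<^sup>2 - (norm (G 0))\<^sup>2"
proof -
  define g where "g z = G z / of_real N" for z
  define a where "a = g 0"
  have g1: "norm (g z) < 1" if "norm z < 1" for z
    using bound[OF that] N by (simp add: g_def norm_divide)
  then have a1: "norm a < 1" by (simp add: a_def)
  have "(\<lambda>z. Moebius_function 0 a (g z)) holomorphic_on ball 0 1"
  proof (rule holomorphic_on_compose_gen[of g _ "Moebius_function 0 a" "ball 0 1", unfolded o_def])
    show "g holomorphic_on ball 0 1"
      unfolding g_def using N by (intro holomorphic_intros hol) simp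
    show "Moebius_function 0 a holomorphic_on ball 0 1"
      by (rule Moebius_function_holomorphic[OF a1])
    show "g ` ball 0 1 \<subseteq> ball 0 1"
      using g1 by auto
  qed
  then have "norm (Moebius_function 0 a (g (1 / 2))) \<le> norm (1 / 2 :: complex)"
    by (rule Schwarz_Lemma(1))
      (use a1 g1 in \<open>auto simp: a_def Moebius_function_eq_zero Moebius_function_norm_lt_1\<close>)
  moreover have ne: "1 - cnj a * g (1 / 2) \<noteq> 0"
  proof
    assume "1 - cnj a * g (1 / 2) = 0"
    then have "norm a * norm (g (1 / 2)) = 1"
      by (metis complex_mod_cnj eq_iff_diff_eq_0 norm_mult norm_one)
    moreover have "norm a * norm (g (1 / 2)) < 1 * 1"
      by (intro mult_strict_mono a1 g1) (auto simp: norm_divide)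
    ultimately show False by simp
  qed
  ultimately have "2 * norm (g (1 / 2) - a) \<le> norm (1 - cnj a * g (1 / 2))"
    by (simp add: Moebius_function_simple norm_divide divide_simps)
  also have "1 - cnj a * g (1 / 2) = of_real (1 - (norm a)\<^sup>2) - cnj a * (g (1 / 2) - a)"
    using complex_norm_square[of a] by (simp add: algebra_simps)
  also have "norm \<dots> \<le> norm (of_real (1 - (norm a)\<^sup>2) :: complex) + norm (cnj a * (g (1 / 2) - a))"
    by (rule norm_triangle_ineq4)
  also have "\<dots> \<le> (1 - (norm a)\<^sup>2) + norm (g (1 / 2) - a)"
    using a1 by (intro add_mono) (auto simp: norm_mult abs_square_le_1 intro!: mult_left_le_one_le
      simp flip: of_real_power of_real_diff)
  finally have "norm (g (1 / 2) - a) \<le> 1 - (norm a)\<^sup>2" by simp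
  moreover have "N * norm (g (1 / 2) - a) = norm (G (1 / 2) - G 0)" "N * norm a = norm (G 0)"
    using N by (simp_all add: g_def a_def norm_divide flip: diff_divide_distrib)
  moreover have "N * (N * norm (g (1 / 2) - a)) \<le> N\<^sup>2 - (N * norm a)\<^sup>2"
    using mult_left_mono[OF calculation(1), of "N\<^sup>2"] by (simp add: power2_eq_square algebra_simps)
  ultimately show ?thesis by simp
qed

text \<open>
  Move from \<open>x = s v\<close>, where \<open>v\<close> is a unit vector, to the point \<open>y\<close> on the disc through \<open>v\<close> at
  pseudohyperbolic distance \<open>1/2\<close> from \<open>x\<close>. Along this disc the Schwarz--Pick inequality keeps
  \<open>f y\<close> close to \<open>f x\<close>. With \<open>l\<close> a norming functional of \<open>v\<close>, the Moebius transformation moving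
  \<open>s\<close> to \<open>0\<close>, composed with \<open>l\<close>, is a function in the unit ball of \<open>H\<^sup>\<infinity>\<close> with value \<open>0\<close> at \<open>x\<close> and
  \<open>1/2\<close> at \<open>y\<close>, which keeps \<open>\<delta>\<^sub>x\<close> and \<open>\<delta>\<^sub>y\<close> apart.
\<close>

lemma separated_point_of_almost_equal_value:
  fixes f :: "'e::complex_normed_vector hinf"
  assumes nontrivial: "(UNIV :: 'e set) \<noteq> {0}" and N: "norm f < N" and x: "x \<in> ball 0 1"
  obtains y where "y \<in> ball 0 1"
    "N * norm (apply_hinf f y - apply_hinf f x) \<le> N\<^sup>2 - (norm (apply_hinf f x))\<^sup>2"
    "1 / 2 \<le> norm (point_eval x - point_eval y)"
proof -
  define s where "s = complex_of_real (norm x)"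
  have s1: "norm s < 1" using x by (simp add: s_def)
  obtain v where v: "norm v = 1" "x = norm x *\<^sub>R v"
  proof (cases "x = 0")
    case True
    from nontrivial obtain w :: 'e where "w \<noteq> 0" by blast
    then show ?thesis
      using True by (intro that[of "w /\<^sub>R norm w"]) auto
  next
    case False
    then show ?thesis
      by (intro that[of "x /\<^sub>R norm x"]) auto
  qed
  have sv: "s *\<^sub>C v = x"
    using v(2) by (simp add: s_def scaleC_of_real)
  define m where "m = Moebius_function 0 (- s)"
  have m1: "norm (m z) < 1" if "norm z < 1" for z
    unfolding m_def using that s1 by (intro Moebius_function_norm_lt_1) auto
  have m0: "m 0 = s"
    by (simp add: m_def Moebius_function_of_zero)
  have in_ball: "w *\<^sub>C v \<in> ball 0 1" if "norm w < 1" for w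
    using that v by (simp add: norm_scaleC)
  define y where "y = m (1 / 2) *\<^sub>C v"
  have y: "y \<in> ball 0 1"
    unfolding y_def by (intro in_ball m1) (simp add: norm_divide)
  have "(\<lambda>z. apply_hinf f (m z *\<^sub>C v)) holomorphic_on ball 0 1"
  proof (rule holomorphic_on_compose_gen[of m _ "\<lambda>w. apply_hinf f (w *\<^sub>C v)" "ball 0 1", unfolded o_def])
    show "m holomorphic_on ball 0 1"
      unfolding m_def using s1 by (intro Moebius_function_holomorphic) simp
    show "m ` ball 0 1 \<subseteq> ball 0 1"
      using m1 by auto
    have "((\<lambda>w. apply_hinf f (w *\<^sub>C v)) has_field_derivative hinf_deriv f (z *\<^sub>C v) v) (at z)"
      if "z \<in> ball 0 1" for z
      using has_field_derivative_along_line[of "hinf_deriv f (z *\<^sub>C v)" "apply_hinf f" 0 z v]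
        hinf_has_derivative[OF in_ball[of z], of f] that by simp
    then show "(\<lambda>w. apply_hinf f (w *\<^sub>C v)) holomorphic_on ball 0 1"
      unfolding holomorphic_on_open[OF open_ball] by blast
  qed
  moreover have f_less: "norm (apply_hinf f w) < N" for w
    using norm_apply_hinf_le N by (rule le_less_trans)
  moreover have "0 < N"
    using norm_ge_zero N by (rule le_less_trans)
  ultimately have "N * norm (apply_hinf f (m (1 / 2) *\<^sub>C v) - apply_hinf f (m 0 *\<^sub>C v))
      \<le> N\<^sup>2 - (norm (apply_hinf f (m 0 *\<^sub>C v)))\<^sup>2"
    by (intro Schwarz_Pick_half)
  then have close: "N * norm (apply_hinf f y - apply_hinf f x) \<le> N\<^sup>2 - (norm (apply_hinf f x))\<^sup>2"
    by (simp add: y_def m0 sv)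
  obtain l :: "'e \<Rightarrow> complex" where l: "complex_linear l" "l v = 1" "\<And>x. norm (l x) \<le> norm x"
    using norming_functional[OF v(1)] by blast
  have lv: "l (c *\<^sub>C v) = c" for c
    using l(1,2) by (simp add: complex_linear_def scaleC_complex_def)
  have l1: "l w \<in> ball 0 1" if "w \<in> ball 0 1" for w
    using l(3)[of w] that by simp
  have "holomorphic_on_unit_ball (\<lambda>w. Moebius_function 0 s (l w))"
    unfolding holomorphic_on_unit_ball_def
  proof
    fix w :: 'e assume w: "w \<in> ball 0 1"
    obtain D where "(Moebius_function 0 s has_field_derivative D) (at (l w))"
      using Moebius_function_holomorphic[OF s1, of 0] l1[OF w]
      unfolding holomorphic_on_open[OF open_ball] by blast
    then have "(Moebius_function 0 s has_derivative (*) D) (at (l w))"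
      by (simp add: has_field_derivative_def)
    moreover have "(l has_derivative l) (at w)"
      using complex_linear_imp_bounded_linear[OF l(1), of 1] l(3)
      by (intro bounded_linear_imp_has_derivative) simp
    ultimately have "((\<lambda>w. Moebius_function 0 s (l w)) has_derivative (\<lambda>k. D * l k)) (at w)"
      using has_derivative_compose by blast
    moreover have "complex_linear (\<lambda>k. D * l k)"
      using l(1) by (simp add: complex_linear_def scaleC_complex_def algebra_simps)
    ultimately show "\<exists>F'. complex_linear F' \<and> ((\<lambda>w. Moebius_function 0 s (l w)) has_derivative F') (at w)"
      by blast
  qed
  moreover have "norm (Moebius_function 0 s (l w)) \<le> 1" if "w \<in> ball 0 1" for w
    using Moebius_function_norm_lt_1[OF s1, of "l w" 0] l1[OF that] by simp
  ultimately obtain h :: "'e hinf"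
    where h: "\<And>w. w \<in> ball 0 1 \<Longrightarrow> apply_hinf h w = Moebius_function 0 s (l w)" "norm h \<le> 1"
    using hinf_of_holomorphic[of "\<lambda>w. Moebius_function 0 s (l w)" 1] by auto
  have "l x = s"
    using lv[of s] sv by simp
  then have "apply_hinf h x = 0"
    using h(1)[OF x] by (simp add: Moebius_function_eq_zero)
  moreover have "apply_hinf h y = 1 / 2"
    using h(1)[OF y] lv[of "m (1 / 2)"] Moebius_function_compose[of s "- s" "1 / 2"] s1
    by (simp add: y_def m_def norm_divide)
  ultimately have "functional_of_ginf (point_eval x - point_eval y) h = - (1 / 2)"
    by (simp only: functional_of_ginf_diff functional_of_point_eval) simp
  then have "1 / 2 = norm (functional_of_ginf (point_eval x - point_eval y) h)"
    by (simp only: norm_minus_cancel norm_divide norm_one norm_numeral)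
  also have "\<dots> \<le> norm (point_eval x - point_eval y) * 1"
    using norm_functional_of_ginf_le h(2) by (meson mult_left_mono norm_ge_zero order_trans)
  finally show ?thesis
    using that[OF y close] by simp
qed

text \<open>
  With \<open>\<parallel>f\<parallel> - e < \<bar>f x\<bar>\<close> and \<open>N = \<parallel>f\<parallel> + e\<close>, the bound \<open>N\<^sup>2 - \<bar>f x\<bar>\<^sup>2\<close> of the previous lemma
  is at most \<open>(\<parallel>f\<parallel> + e)\<^sup>2 - (\<parallel>f\<parallel> - e)\<^sup>2 = 4 e \<parallel>f\<parallel>\<close>.
\<close>

lemma separated_almost_maximum_points:
  fixes f :: "'e::complex_normed_vector hinf"
  assumes nontrivial: "(UNIV :: 'e set) \<noteq> {0}" and e: "0 < e" "e < norm f"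
  obtains x y where "x \<in> ball 0 1" "y \<in> ball 0 1" "norm f - e < norm (apply_hinf f x)"
    "norm (apply_hinf f y - apply_hinf f x) \<le> 4 * e" "1 / 2 \<le> norm (point_eval x - point_eval y)"
proof -
  have "\<exists>x\<in>ball 0 1. norm f - e < norm (apply_hinf f x)"
    using norm_hinf_le[of f "norm f - e"] e(1) by force
  then obtain x where x: "x \<in> ball 0 1" "norm f - e < norm (apply_hinf f x)" by blast
  let ?N = "norm f + e"
  obtain y where y: "y \<in> ball 0 1"
    "?N * norm (apply_hinf f y - apply_hinf f x) \<le> ?N\<^sup>2 - (norm (apply_hinf f x))\<^sup>2"
    "1 / 2 \<le> norm (point_eval x - point_eval y)"
    by (rule separated_point_of_almost_equal_value[OF nontrivial _ x(1), of f ?N]) (use e in auto)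
  have "(norm f - e)\<^sup>2 \<le> (norm (apply_hinf f x))\<^sup>2"
    using x(2) e by (intro power_mono) auto
  then have "?N\<^sup>2 - (norm (apply_hinf f x))\<^sup>2 \<le> 4 * e * norm f"
    by (simp add: power2_eq_square algebra_simps)
  also have "\<dots> \<le> 4 * e * ?N"
    using e by (intro mult_left_mono) auto
  finally have "?N * norm (apply_hinf f y - apply_hinf f x) \<le> ?N * (4 * e)"
    using y(2) by (simp only: mult.commute)
  moreover have "0 < ?N" using e by linarith
  ultimately have "norm (apply_hinf f y - apply_hinf f x) \<le> 4 * e"
    by (simp only: mult_le_cancel_left_pos)
  with x y show ?thesis by (intro that)
qed

section \<open>Absence of strongly exposed points\<close>

text \<open>
  Rotated and slightly shrunk point evaluations at almost maximal, uniformly separated points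
  \<open>X n\<close> and \<open>Y n\<close> form two sequences in the open ball on which the real part of \<open>\<xi>\<close> tends to its
  norm. They cannot have the same limit, as they stay at distance at least \<open>1/4\<close> from each other.
\<close>

lemma no_strongly_exposing_functional:
  fixes \<xi> :: "'e::complex_normed_vector ginf \<Rightarrow>\<^sub>L complex"
  assumes nontrivial: "(UNIV :: 'e set) \<noteq> {0}"
    and \<xi>: "complex_linear (blinfun_apply \<xi>)" "\<xi> \<noteq> 0"
    and exposes: "\<And>u. (\<And>n. u n \<in> ball 0 1) \<Longrightarrow> (\<lambda>n. Re (\<xi> (u n))) \<longlonglongrightarrow> norm \<xi> \<Longrightarrow> u \<longlonglongrightarrow> \<phi>"
  shows False
proof -
  define M where "M = norm \<xi>"
  have M: "0 < M" using \<xi>(2) by (simp add: M_def)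
  obtain f :: "'e hinf" where rep: "\<And>\<phi>. \<xi> \<phi> = functional_of_ginf \<phi> f" and "norm f = norm \<xi>"
    using dual_of_ginf_is_hinf[OF \<xi>(1)] by blast
  then have norm_f: "norm f = M" by (simp add: M_def)
  \<comment> \<open>Serves both as relative error in the choice of the points and as shrinking factor; starting
    at \<open>1/2\<close> it keeps the multiples at least half as large as the point evaluations.\<close>
  define t where "t n = inverse (real (Suc (Suc n)))" for n
  have t: "0 < t n" "t n \<le> 1 / 2" for n
    by (auto simp: t_def field_simps)
  have t0: "t \<longlonglongrightarrow> 0"
    unfolding t_def using LIMSEQ_Suc[OF LIMSEQ_inverse_real_of_nat] by simp
  have "\<exists>x y. x \<in> ball 0 1 \<and> y \<in> ball 0 1 \<and> M - M * t n < norm (apply_hinf f x) \<and>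
      norm (apply_hinf f y - apply_hinf f x) \<le> 4 * (M * t n) \<and> 1 / 2 \<le> norm (point_eval x - point_eval y)" for n
  proof (rule separated_almost_maximum_points[OF nontrivial, of "M * t n" f])
    show "0 < M * t n" using M t by simp
    show "M * t n < norm f"
      using mult_strict_left_mono[of "t n" 1 M] M t(2)[of n] by (simp add: norm_f)
  qed (use norm_f in auto)
  then obtain X Y where "\<And>n. X n \<in> ball 0 1" "\<And>n. Y n \<in> ball 0 1"
    and max: "\<And>n. M - M * t n < norm (apply_hinf f (X n))"
    and close: "\<And>n. norm (apply_hinf f (Y n) - apply_hinf f (X n)) \<le> 4 * (M * t n)"
    and sep: "\<And>n. 1 / 2 \<le> norm (point_eval (X n) - point_eval (Y n))"
    by metis
  \<comment> \<open>The phase makes \<open>\<xi>\<close> positive at the first sequence; the factor \<open>1 - t n\<close> keeps both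
    sequences inside the open ball.\<close>
  define b where "b n = complex_of_real (1 - t n) * cnj (sgn (apply_hinf f (X n)))" for n
  have nz: "apply_hinf f (X n) \<noteq> 0" for n
  proof -
    have "M * t n \<le> M * 1"
      using M t(2)[of n] by (intro mult_left_mono) auto
    with max[of n] show ?thesis by auto
  qed
  have norm_b: "norm (b n) = 1 - t n" for n
    using nz[of n] t(2)[of n] by (simp add: b_def norm_mult norm_sgn del: of_real_diff)
  define u where "u n = b n *\<^sub>C point_eval (X n)" for n
  define v where "v n = b n *\<^sub>C point_eval (Y n)" for n
  have in_ball: "b n *\<^sub>C point_eval x \<in> ball 0 1" for n x
  proof -
    have "norm (b n *\<^sub>C point_eval x) \<le> (1 - t n) * 1"
      unfolding norm_scaleC norm_b using t(2)[of n] by (intro mult_left_mono norm_point_eval_le) simp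
    then show ?thesis using t(1)[of n] by simp
  qed
  have \<xi>_u: "\<xi> (u n) = of_real ((1 - t n) * norm (apply_hinf f (X n)))" for n
    using cnj_sgn_mult[of "apply_hinf f (X n)"]
    by (simp add: rep u_def functional_of_ginf_scaleC b_def mult.assoc)
  have u_lim: "\<bar>Re (\<xi> (u n)) - M\<bar> \<le> t n * (2 * M)" for n
  proof -
    have "(1 - t n) * norm (apply_hinf f (X n)) \<le> 1 * M"
      using t[of n] norm_apply_hinf_le[of f "X n"] norm_f by (intro mult_mono) auto
    moreover have "(1 - t n) * (M - M * t n) \<le> (1 - t n) * norm (apply_hinf f (X n))"
      using t(2)[of n] max[of n] by (intro mult_left_mono) auto
    moreover have "(1 - t n) * (M - M * t n) = M - t n * (2 * M) + M * (t n)\<^sup>2"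
      by (simp add: power2_eq_square algebra_simps)
    moreover have "0 \<le> M * (t n)\<^sup>2" using M by simp
    moreover have "0 \<le> t n * (2 * M)" using M t(1)[of n] by simp
    ultimately show ?thesis
      unfolding \<xi>_u Re_complex_of_real by linarith
  qed
  have v_lim: "\<bar>Re (\<xi> (v n)) - M\<bar> \<le> t n * (6 * M)" for n
  proof -
    have "\<xi> (v n) - \<xi> (u n) = b n * (apply_hinf f (Y n) - apply_hinf f (X n))"
      by (simp add: rep u_def v_def functional_of_ginf_scaleC algebra_simps)
    then have "norm (\<xi> (v n) - \<xi> (u n)) \<le> 1 * (4 * (M * t n))"
      unfolding norm_mult norm_b using t[of n] close[of n]
      by (simp only: norm_mult norm_b) (intro mult_mono; simp)
    then have "\<bar>Re (\<xi> (v n)) - Re (\<xi> (u n))\<bar> \<le> t n * (4 * M)"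
      using abs_Re_le_cmod[of "\<xi> (v n) - \<xi> (u n)"] by (simp add: mult_ac)
    with u_lim[of n] show ?thesis by (simp add: algebra_simps)
  qed
  have lim: "(\<lambda>n. Re (\<xi> (w n))) \<longlonglongrightarrow> norm \<xi>" if "\<And>n. \<bar>Re (\<xi> (w n)) - M\<bar> \<le> t n * c" for w c
  proof (rule LIM_zero_cancel, rule Lim_null_comparison)
    show "(\<lambda>n. t n * c) \<longlonglongrightarrow> 0"
      by (rule tendsto_mult_left_zero[OF t0])
  qed (use that in \<open>simp flip: M_def\<close>)
  have "u \<longlonglongrightarrow> \<phi>"
  proof (rule exposes)
    show "u n \<in> ball 0 1" for n unfolding u_def by (rule in_ball)
    show "(\<lambda>n. Re (\<xi> (u n))) \<longlonglongrightarrow> norm \<xi>"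
      by (rule lim[OF u_lim])
  qed
  moreover have "v \<longlonglongrightarrow> \<phi>"
  proof (rule exposes)
    show "v n \<in> ball 0 1" for n unfolding v_def by (rule in_ball)
    show "(\<lambda>n. Re (\<xi> (v n))) \<longlonglongrightarrow> norm \<xi>"
      by (rule lim[OF v_lim])
  qed
  ultimately have "(\<lambda>n. u n - v n) \<longlonglongrightarrow> \<phi> - \<phi>"
    by (rule tendsto_diff)
  then have "(\<lambda>n. norm (u n - v n)) \<longlonglongrightarrow> 0"
    using tendsto_norm_zero by fastforce
  moreover have "1 / 4 \<le> norm (u n - v n)" for n
  proof -
    have "u n = b n *\<^sub>C (point_eval (X n) - point_eval (Y n)) + v n"
      unfolding u_def v_def scaleC_add_right[symmetric] by simp
    then have "norm (u n - v n) = (1 - t n) * norm (point_eval (X n) - point_eval (Y n))"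
      by (simp add: norm_scaleC norm_b)
    moreover have "1 / 2 * (1 / 2) \<le> (1 - t n) * norm (point_eval (X n) - point_eval (Y n))"
      using t(2)[of n] sep[of n] by (intro mult_mono) auto
    ultimately show ?thesis by simp
  qed
  ultimately have "1 / 4 \<le> (0 :: real)"
    by (intro tendsto_lowerbound[of _ 0 sequentially]) auto
  then show False by simp
qed

lemma point_eval_nonzero:
  assumes "x \<in> ball 0 1"
  shows "point_eval (x :: 'e::complex_normed_vector) \<noteq> 0"
proof
  assume 0: "point_eval x = 0"
  have "holomorphic_on_unit_ball (\<lambda>_ :: 'e. 1)"
    by (auto simp: holomorphic_on_unit_ball_def complex_linear_def scaleC_complex_def
        intro!: exI[of _ "\<lambda>_. 0"])
  then obtain g :: "'e hinf" where "\<And>x. x \<in> ball 0 1 \<Longrightarrow> apply_hinf g x = 1"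
    by (rule hinf_of_holomorphic[where B = 1]) auto
  with assms have "functional_of_ginf (point_eval x) g = 1" by simp
  with 0 show False by (simp add: zero_ginf.rep_eq)
qed

text \<open>
  A functional exposing a point of the closed unit ball attains its norm there. It is nonzero,
  because the zero functional exposes a point only of a singleton, and the ball contains
  \<open>0 \<noteq> \<delta>\<^sub>0\<close>.
\<close>

lemma strongly_exposed_points_cball_empty:
  assumes nontrivial: "(UNIV :: 'e::complex_normed_vector set) \<noteq> {0}"
  shows "strongly_exposed_points (cball 0 1 :: 'e ginf set) = {}"
proof (rule ccontr)
  assume "strongly_exposed_points (cball 0 1 :: 'e ginf set) \<noteq> {}"
  then obtain \<phi> :: "'e ginf" and \<xi> :: "'e ginf \<Rightarrow>\<^sub>L complex" where \<phi>: "\<phi> \<in> cball 0 1"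
    and \<xi>: "complex_linear (blinfun_apply \<xi>)" and max: "\<And>\<psi>. \<psi> \<in> cball 0 1 \<Longrightarrow> Re (\<xi> \<psi>) \<le> Re (\<xi> \<phi>)"
    and conv: "\<And>u. (\<And>n. u n \<in> cball 0 1) \<Longrightarrow> (\<lambda>n. Re (\<xi> (u n))) \<longlonglongrightarrow> Re (\<xi> \<phi>) \<Longrightarrow> u \<longlonglongrightarrow> \<phi>"
    unfolding strongly_exposed_points_def by blast
  have "\<xi> \<noteq> 0"
  proof
    assume "\<xi> = 0"
    then have "(\<lambda>_ :: nat. \<psi>) \<longlonglongrightarrow> \<phi>" if "\<psi> \<in> cball 0 1" for \<psi>
      using that by (intro conv) auto
    then have "\<psi> = \<phi>" if "\<psi> \<in> cball 0 1" for \<psi>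
      using that by (simp add: LIMSEQ_const_iff)
    from this[of 0] this[of "point_eval 0"] have "point_eval (0 :: 'e) = 0"
      using norm_point_eval_le[of "0 :: 'e"] by simp
    then show False
      using point_eval_nonzero[of "0 :: 'e"] by simp
  qed
  have bound: "norm (\<xi> \<psi>) \<le> Re (\<xi> \<phi>) * norm \<psi>" for \<psi>
  proof (cases "\<psi> = 0")
    case False
    define c where "c = cnj (sgn (\<xi> \<psi>)) / of_real (norm \<psi>)"
    have "c *\<^sub>C \<psi> \<in> cball 0 1"
      using False by (simp add: c_def norm_scaleC norm_divide norm_sgn)
    from max[OF this] have "Re (c * \<xi> \<psi>) \<le> Re (\<xi> \<phi>)"
      using \<xi> by (simp add: complex_linear_def scaleC_complex_def)
    moreover have "c * \<xi> \<psi> = of_real (norm (\<xi> \<psi>) / norm \<psi>)"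
      using cnj_sgn_mult[of "\<xi> \<psi>"] by (simp add: c_def)
    ultimately have "norm (\<xi> \<psi>) / norm \<psi> \<le> Re (\<xi> \<phi>)"
      by (simp only: Re_complex_of_real)
    then show ?thesis
      using False by (simp add: field_simps)
  qed simp
  have "0 \<le> Re (\<xi> \<phi>)"
    using max[of 0] by simp
  then have "norm \<xi> \<le> Re (\<xi> \<phi>)"
    by (rule norm_blinfun_bound) (rule bound)
  moreover have "Re (\<xi> \<phi>) \<le> norm \<xi>"
  proof -
    have "Re (\<xi> \<phi>) \<le> norm \<xi> * norm \<phi>"
      using complex_Re_le_cmod norm_blinfun order_trans by blast
    also have "\<dots> \<le> norm \<xi>"
      using \<phi> by (simp add: mult_left_le)
    finally show ?thesis .
  qed
  ultimately have eq: "Re (\<xi> \<phi>) = norm \<xi>" by simp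
  show False
    using nontrivial \<xi> \<open>\<xi> \<noteq> 0\<close>
  proof (rule no_strongly_exposing_functional)
    fix u :: "nat \<Rightarrow> 'e ginf"
    assume "\<And>n. u n \<in> ball 0 1" "(\<lambda>n. Re (\<xi> (u n))) \<longlonglongrightarrow> norm \<xi>"
    then show "u \<longlonglongrightarrow> \<phi>"
      by (intro conv) (auto simp: eq intro: less_imp_le)
  qed
qed

theorem corollary2p2:
  assumes "(UNIV :: 'e::complex_banach set) \<noteq> {0}"
  shows "(\<nexists>x :: 'e ginf. strongly_exposed x) \<and> \<not> radon_nikodym_property TYPE('e ginf)"
proof
  show "\<nexists>x :: 'e ginf. strongly_exposed x"
  proof
    assume "\<exists>x :: 'e ginf. strongly_exposed x"
    then obtain x :: "'e ginf" and \<xi> :: "'e ginf \<Rightarrow>\<^sub>L complex"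
      where \<xi>: "complex_linear (blinfun_apply \<xi>)" "norm \<xi> = 1"
        and conv: "\<And>u. (\<And>n. u n \<in> ball 0 1) \<Longrightarrow> (\<lambda>n. Re (\<xi> (u n))) \<longlonglongrightarrow> 1 \<Longrightarrow> u \<longlonglongrightarrow> x"
      unfolding strongly_exposed_def by blast
    from \<xi>(2) have "\<xi> \<noteq> 0" by auto
    with assms \<xi>(1) show False
      by (rule no_strongly_exposing_functional[where \<phi> = x]) (use \<xi>(2) conv in auto)
  qed
  show "\<not> radon_nikodym_property TYPE('e ginf)"
  proof
    assume "radon_nikodym_property TYPE('e ginf)"
    then have "(cball 0 1 :: 'e ginf set) = closure (convex hull strongly_exposed_points (cball 0 1))"
      unfolding radon_nikodym_property_def by (metis bounded_cball closed_cball convex_cball)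
    then have "(cball 0 1 :: 'e ginf set) = {}"
      using strongly_exposed_points_cball_empty[OF assms] by simp
    then show False by simp
  qed
qed

end
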